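(* Let $(X,\mathbf d)$ be a metric space and $\mathbf 0\in X$ a point such that, for every $R>0$, the closed ball $\overline B_X(\mathbf 0,R)$ is compact. Let $\Gamma\subset X$ be nonempty and closed, and let $g\colon\Gamma\to\mathbb R_+$ be Lipschitz continuous with Lipschitz constant $L_g$. Assume that there exists $D>0$ such that, for every $x,y\in X$, there exist $T\in[0,D\,\mathbf d(x,y)]$ and a Lipschitz continuous $\gamma\colon[0,T]\to X$ with $\gamma(0)=x$, $\gamma(T)=y$ and $|\dot\gamma|(t)=1$ for almost every $t\in[0,T]$. Let $K\colon\mathcal P(X)\times X\to\mathbb R_+$ be continuous and assume that there exist $K_{\min},K_{\max}>0$ with $K(\mu,x)\in[K_{\min},K_{\max}]$ for all $(\mu,x)\in\mathcal P(X)\times X$; that for every $R>0$ there exists $L_R>0$ with $|K(\mu,x_1)-K(\mu,x_2)|\le L_R\,\mathbf d(x_1,x_2)$ for all $\mu\in\mathcal P(X)$ and $x_1,x_2\in\overline B_X(\mathbf 0,R)$; and that $L_gK_{\max}<1$. Let $m_0\in\mathcal P(X)$, let $Q\in\mathcal P(\mathcal C_X)$ be an equilibrium of $\mathrm{MFG}(X,\Gamma,K,g,m_0)$ and, for $t\in[0,+\infty]$, define $m_t={e_t}_\#Q$. Let $k(t,x)=K(m_t,x)$ for $(t,x)\in\mathbb R_+\times X$, and let $\psi\colon\mathbb R_+\to\mathbb R_+$ be a nondecreasing function with linear growth, depending only on $\mathbf 0,\Gamma,g,D,K_{\min},K_{\max}$, such that for every $R>0$, every $(s,x)\in\mathbb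 R_+\times\overline B_X(\mathbf 0,R)$ and every $\gamma\in\mathrm{Opt}(k,g,s,x)$ one has $\gamma(t)\in\overline B_X(\mathbf 0,\psi(R))$ for all $t\ge0$. (a) We have $m_t\to m_\infty$ in $\mathcal P(X)$ as $t\to+\infty$. (b) Let $p\in[1,+\infty)$ and assume that $m_0\in\mathcal P_p(X)$. Then $m_t\in\mathcal P_p(X)$ for every $t\in[0,+\infty]$. Moreover, there exist constants $\alpha>0$ and $t_0\ge0$ depending only on $\mathbf 0,\Gamma,g,D,K_{\min},K_{\max}$ such that, for all $t\ge t_0$, $$\mathbf W_p(m_t,m_\infty)^p\le 2^p\int_{X\setminus\overline B_X(\mathbf 0,\alpha(t-t_0))}\psi(\mathbf d(\mathbf 0,x))^p\,\mathrm dm_0(x).$$ (c) Assume that $m_0$ is compactly supported. Then $m_t$ is compactly supported for every $t\in[0,+\infty]$ and there exists $t_\ast\ge0$ such that $m_t=m_\infty$ for every $t\ge t_\ast$.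
   Context: $\mathbb R_+=[0,+\infty)$. $\mathcal C_X=\mathcal C(\mathbb R_+,X)$ is endowed with the topology of uniform convergence on compact sets; $\mathrm{Lip}(X)$ is the set of Lipschitz continuous functions from $\mathbb R_+$ to $X$. For a Polish space $Y$, $\mathcal P(Y)$ is the set of Borel probability measures on $Y$ with the topology of weak convergence of measures. For $t\in\mathbb R_+$, $e_t\colon\mathcal C_X\to X$, $e_t(\gamma)=\gamma(t)$; $f_\#\mu$ denotes pushforward. The metric derivative of a curve $\gamma$ is $|\dot\gamma|(t)=\lim_{s\to t}\mathbf d(\gamma(s),\gamma(t))/|s-t|$ (it exists a.e. for Lipschitz curves). A function $f\colon\mathbb R_+\to\mathbb R_+$ has linear growth if $f(R)\le AR+B$ for all $R$, for some constants $A,B\geq 0$. Optimal control problem. Given continuous $k\colon\mathbb R_+\times X\to\mathbb R_+$, $\mathrm{Adm}(k)$ is the set of $\gamma\in\mathrm{Lip}(X)$ with $|\dot\gamma|(t)\le k(t,\gamma(t))$ for a.e. $t\in\mathbb R_+$. For $t_0\in\mathbb R_+$ and $\gamma\in\mathcal C_X$, $\tau(t_0,\gamma)=\inf\{t\ge0: \gamma(t+t_0)\in\Gamma\}$ (with $\inf\emptyset=+\infty$), and $G(t_0,\gamma)=g(\gamma(t_0+\tau(t_0,\gamma)))$ if $\tau(t_0,\gamma)<+\infty$, $G(t_0,\gamma)=+\infty$ otherwise. $\mathrm{Opt}(k,g,t_0,x_0)$ is the set of optimal curves for $(k,g,t_0,x_0)$, that is, of $\gamma\in\mathrm{Adm}(k)$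 such that $\gamma(t)=x_0$ for $t\in[0,t_0]$, $\tau(t_0,\gamma)<+\infty$, $\gamma(t)=\gamma(t_0+\tau(t_0,\gamma))\in\Gamma$ for all $t\ge t_0+\tau(t_0,\gamma)$, and $\tau(t_0,\gamma)+G(t_0,\gamma)=\min\{\tau(t_0,\beta)+G(t_0,\beta): \beta\in\mathrm{Adm}(k),\ \beta(t_0)=x_0\}$. Equilibria. For $Q\in\mathcal P(\mathcal C_X)$ put $k_Q(t,x)=K({e_t}_\#Q,x)$. $Q$ is an equilibrium of $\mathrm{MFG}(X,\Gamma,K,g,m_0)$ if ${e_0}_\#Q=m_0$ and $Q$-almost every $\gamma\in\mathcal C_X$ belongs to $\mathrm{Opt}(k_Q,g,0,\gamma(0))$ (under the hypotheses of the statement, this is equivalent to requiring the same for every $\gamma\in\mathrm{supp}(Q)$). Limit at infinity. $\mathcal C_{\lim}(X)$ is the Borel set of $\gamma\in\mathcal C_X$ for which $\lim_{t\to+\infty}\gamma(t)$ exists, and $e_\infty\colon\mathcal C_{\lim}(X)\to X$, $e_\infty(\gamma)=\lim_{t\to+\infty}\gamma(t)$, which is Borel measurable. Since optimal curves are eventually constant, an equilibrium $Q$ is concentrated on $\mathcal C_{\lim}(X)$, so $m_\infty={e_\infty}_\#Q\in\mathcal P(X)$ is well defined. Wasserstein. $\mathcal P_p(X)$ is the set of $\mu\in\mathcal P(X)$ with $\int_X\mathbf d(x,\overline x)^p\,\mathrm d\mu(x)<+\infty$ for some (equivalently every) $\overline x\in X$, and $\mathbf W_p(\mu,\nu)=\inf\{\int_{X\times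 X}\mathbf d(x,y)^p\,\mathrm d\lambda(x,y): \lambda\in\mathcal P(X\times X)\text{ with marginals }\mu,\nu\}^{1/p}$. A function $\psi$ as in the statement always exists under the stated hypotheses. *)

theory Defs
  imports "HOL-Probability.Probability"
begin

text \<open>
  Curves on \<open>[0, \<infinity>)\<close> are functions on the reals restricted to \<open>{0..}\<close> by extensionality, so that
  equality of curves is equality of functions on \<open>[0, \<infinity>)\<close>.
\<close>

definition curves :: "(real \<Rightarrow> 'a::metric_space) set" where
  "curves = {\<gamma> \<in> extensional {0..}. continuous_on {0..} \<gamma>}"

definition lipschitz_curves :: "(real \<Rightarrow> 'a::metric_space) set" where
  "lipschitz_curves = {\<gamma> \<in> extensional {0..}. \<exists>L. L-lipschitz_on {0..} \<gamma>}"

text \<open>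
  The topology of uniform convergence on compact subsets of \<open>[0, \<infinity>)\<close>; since suprema over
  compact sets are attained, the generating sets form a base.
\<close>

definition curve_topology :: "(real \<Rightarrow> 'a::metric_space) topology" where
  "curve_topology = topology_generated_by
     {{\<beta> \<in> curves. \<forall>t\<in>C. dist (\<beta> t) (\<gamma> t) < \<epsilon>} | \<gamma> C \<epsilon>.
        \<gamma> \<in> curves \<and> compact C \<and> C \<subseteq> {0..} \<and> 0 < \<epsilon>}"

definition curve_borel :: "(real \<Rightarrow> 'a::metric_space) measure" where
  "curve_borel = sigma curves {U. openin curve_topology U}"

text \<open>
  A relation rather than a function, so that inequalities on the metric derivative of a curve
  \<open>\<gamma> : S \<rightarrow> X\<close> include its existence (which holds a.e. for Lipschitz curves).
\<close>

definition has_metric_derivative ::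
    "(real \<Rightarrow> 'a::metric_space) \<Rightarrow> real set \<Rightarrow> real \<Rightarrow> real \<Rightarrow> bool" where
  "has_metric_derivative \<gamma> S t v \<longleftrightarrow>
     ((\<lambda>s. dist (\<gamma> s) (\<gamma> t) / \<bar>s - t\<bar>) \<longlongrightarrow> v) (at t within S)"

definition prob_measures :: "'b measure \<Rightarrow> 'b measure set" where
  "prob_measures M = {\<mu>. sets \<mu> = sets M \<and> prob_space \<mu>}"

abbreviation borel_probs :: "'a::topological_space measure set" where
  "borel_probs \<equiv> prob_measures borel"

abbreviation curve_probs :: "(real \<Rightarrow> 'a::metric_space) measure set" where
  "curve_probs \<equiv> prob_measures curve_borel"

text \<open>The coarsest topology making \<open>\<mu> \<mapsto> \<integral>f d\<mu>\<close> continuous for all bounded continuous \<open>f\<close>.\<close>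

definition weak_topology :: "'a::topological_space measure topology" where
  "weak_topology = topology_generated_by
     {{\<mu> \<in> borel_probs. (\<integral>x. f x \<partial>\<mu>) \<in> U} | (f :: 'a \<Rightarrow> real) U.
        continuous_on UNIV f \<and> bounded (range f) \<and> open U}"

text \<open>A topological notion: the complement of the support is the largest open null set whenever the
  space is second countable.\<close>

definition measure_support :: "'a::topological_space measure \<Rightarrow> 'a set" where
  "measure_support \<mu> = {x. \<forall>U. open U \<and> x \<in> U \<longrightarrow> emeasure \<mu> U > 0}"

definition compactly_supported :: "'a::topological_space measure \<Rightarrow> bool" where
  "compactly_supported \<mu> \<longleftrightarrow> compact (measure_support \<mu>)"

definition finite_moment_probs :: "real \<Rightarrow> 'a::metric_space measure set" where
  "finite_moment_probs p =
     {\<mu> \<in> borel_probs. \<exists>y. (\<integral>\<^sup>+x. ennreal (dist x y powr p) \<partial>\<mu>) < \<infinity>}"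

text \<open>Real powers on \<open>[0, \<infinity>]\<close>; only used for exponents \<open>p > 0\<close>.\<close>

definition ennreal_powr :: "ennreal \<Rightarrow> real \<Rightarrow> ennreal" where
  "ennreal_powr a p = (if a = \<infinity> then \<infinity> else ennreal (enn2real a powr p))"

definition couplings ::
    "'a::metric_space measure \<Rightarrow> 'a measure \<Rightarrow> ('a \<times> 'a) measure set" where
  "couplings \<mu> \<nu> =
     {\<pi> \<in> borel_probs. distr \<pi> borel fst = \<mu> \<and> distr \<pi> borel snd = \<nu>}"

text \<open>Extended-valued, so that an infinite transport cost is not collapsed to \<open>0\<close>.\<close>

definition wasserstein ::
    "real \<Rightarrow> 'a::metric_space measure \<Rightarrow> 'a measure \<Rightarrow> ennreal" where
  "wasserstein p \<mu> \<nu> =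
     ennreal_powr (INF \<pi>\<in>couplings \<mu> \<nu>. \<integral>\<^sup>+(x, y). ennreal (dist x y powr p) \<partial>\<pi>) (1 / p)"

definition admissible ::
    "(real \<Rightarrow> 'a::metric_space \<Rightarrow> real) \<Rightarrow> (real \<Rightarrow> 'a) set" where
  "admissible k = {\<gamma> \<in> lipschitz_curves.
     AE t in lborel. t \<ge> 0 \<longrightarrow> (\<exists>v. has_metric_derivative \<gamma> {0..} t v \<and> v \<le> k t (\<gamma> t))}"

definition exit_time :: "'a set \<Rightarrow> real \<Rightarrow> (real \<Rightarrow> 'a) \<Rightarrow> ereal" where
  "exit_time \<Gamma> t\<^sub>0 \<gamma> = Inf {ereal t | t. t \<ge> 0 \<and> \<gamma> (t + t\<^sub>0) \<in> \<Gamma>}"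

definition exit_cost :: "'a set \<Rightarrow> ('a \<Rightarrow> real) \<Rightarrow> real \<Rightarrow> (real \<Rightarrow> 'a) \<Rightarrow> ereal" where
  "exit_cost \<Gamma> g t\<^sub>0 \<gamma> =
     (if exit_time \<Gamma> t\<^sub>0 \<gamma> < \<infinity>
      then ereal (g (\<gamma> (t\<^sub>0 + real_of_ereal (exit_time \<Gamma> t\<^sub>0 \<gamma>))))
      else \<infinity>)"

definition optimal_curves ::
    "'a::metric_space set \<Rightarrow> (real \<Rightarrow> 'a \<Rightarrow> real) \<Rightarrow> ('a \<Rightarrow> real) \<Rightarrow> real \<Rightarrow> 'a \<Rightarrow> (real \<Rightarrow> 'a) set"
  where
  "optimal_curves \<Gamma> k g t\<^sub>0 x\<^sub>0 = {\<gamma> \<in> admissible k.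
     (\<forall>t\<in>{0..t\<^sub>0}. \<gamma> t = x\<^sub>0) \<and>
     exit_time \<Gamma> t\<^sub>0 \<gamma> < \<infinity> \<and>
     (let T = t\<^sub>0 + real_of_ereal (exit_time \<Gamma> t\<^sub>0 \<gamma>) in
        \<gamma> T \<in> \<Gamma> \<and> (\<forall>t\<ge>T. \<gamma> t = \<gamma> T)) \<and>
     (\<forall>\<beta>\<in>admissible k. \<beta> t\<^sub>0 = x\<^sub>0 \<longrightarrow>
        exit_time \<Gamma> t\<^sub>0 \<gamma> + exit_cost \<Gamma> g t\<^sub>0 \<gamma> \<le> exit_time \<Gamma> t\<^sub>0 \<beta> + exit_cost \<Gamma> g t\<^sub>0 \<beta>)}"

definition marginal_at ::
    "(real \<Rightarrow> 'a::metric_space) measure \<Rightarrow> real \<Rightarrow> 'a measure" where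
  "marginal_at Q t = distr Q borel (\<lambda>\<gamma>. \<gamma> t)"

definition convergent_curves :: "(real \<Rightarrow> 'a::metric_space) set" where
  "convergent_curves = {\<gamma> \<in> curves. \<exists>x. (\<gamma> \<longlongrightarrow> x) at_top}"

definition marginal_at_infinity ::
    "(real \<Rightarrow> 'a::metric_space) measure \<Rightarrow> 'a measure" where
  "marginal_at_infinity Q = distr (restrict_space Q convergent_curves) borel (\<lambda>\<gamma>. Lim at_top \<gamma>)"

definition is_equilibrium ::
    "'a::metric_space set \<Rightarrow> ('a measure \<Rightarrow> 'a \<Rightarrow> real) \<Rightarrow> ('a \<Rightarrow> real) \<Rightarrow> 'a measure
       \<Rightarrow> (real \<Rightarrow> 'a) measure \<Rightarrow> bool" where
  "is_equilibrium \<Gamma> K g m\<^sub>0 Q \<longleftrightarrow>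
     Q \<in> curve_probs \<and> marginal_at Q 0 = m\<^sub>0 \<and>
     (AE \<gamma> in Q. \<gamma> \<in> optimal_curves \<Gamma> (\<lambda>t. K (marginal_at Q t)) g 0 (\<gamma> 0))"

definition linear_growth :: "(real \<Rightarrow> real) \<Rightarrow> bool" where
  "linear_growth f \<longleftrightarrow> (\<exists>A\<ge>0. \<exists>B\<ge>0. \<forall>R\<ge>0. f R \<le> A * R + B)"

end

theory Submission
  imports Defs
begin

text \<open>
  The whole theorem rests on one estimate: there are \<open>a > 0\<close> and \<open>t\<^sub>0 \<ge> 0\<close>, which do not depend on the
  equilibrium, such that an optimal curve starting at \<open>x\<close> is constant after time
  \<open>a * dist origin x + t\<^sub>0\<close>. Indeed, fix a point \<open>z\<close> of the target \<open>\<Gamma>\<close>. From \<open>x\<close> one can travel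
  to \<open>z\<close> at the speed \<open>Kmin\<close>, which is always allowed, in time at most \<open>D * dist x z / Kmin\<close>; an
  optimal curve does at least as well, its exit cost is nonnegative, and the exit cost of the
  competitor grows at most linearly in \<open>dist x z\<close> because \<open>g\<close> is Lipschitz
  (\<open>optimal_curve_eventually_constant\<close>). That the competitor does not move faster than its speed
  suggests is \<open>lipschitz_on_metric_speed_le\<close>.

  Now let \<open>Q\<close> be an equilibrium. Under \<open>Q\<close> almost every curve is optimal, hence eventually equal to
  its limit, so the evaluation at time \<open>t\<close> converges almost surely to the limit map
  \<open>terminal_point\<close> and the marginals converge weakly by dominated convergence
  (\<open>limitin_weak_topology_distr\<close>). The marginals at times \<open>t\<close> and \<open>\<infinity>\<close> are coupled by the joint law of
  \<open>\<gamma> t\<close> and \<open>terminal_point \<gamma>\<close> (\<open>wasserstein_distr_le\<close>). With \<open>\<alpha> = 1 / a\<close>, these two points agree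
  when \<open>dist origin (\<gamma> 0) \<le> \<alpha> * (t - t\<^sub>0)\<close>, and otherwise both lie in the ball of radius
  \<open>\<psi> (dist origin (\<gamma> 0))\<close>, so that they are at most twice that radius apart; integration gives the
  estimate of the Wasserstein distance. The moment bounds follow from the linear growth of \<open>\<psi>\<close>.
  Finally, if \<open>m\<^sub>0\<close> has bounded support, then all starting points lie in one ball, the curves stay in
  one larger ball, and they have all stopped at a common time.
\<close>

section \<open>Speed bounds for curves in metric spaces\<close>

text \<open>
  A metric-valued curve has no derivative to integrate, so the increments are bounded directly. On
  the null set where the bound \<open>c\<close> may fail, only \<open>L\<close> limits the speed; but this set fits into an
  open set of length less than \<open>\<epsilon>\<close>, which can contribute at most \<open>L * \<epsilon>\<close> to the distance
  travelled; elsewhere the local speed is below \<open>c + \<epsilon>\<close>. Bisection of the interval glues the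
  local bounds together.
\<close>

lemma lipschitz_on_metric_speed_le:
  fixes \<eta> :: "real \<Rightarrow> 'a::metric_space"
  assumes lip: "L-lipschitz_on {a..b} \<eta>" and "c \<ge> 0"
    and speed: "AE t in lborel. t \<in> {a..b} \<longrightarrow> (\<exists>v\<le>c. has_metric_derivative \<eta> {a..b} t v)"
  shows "c-lipschitz_on {a..b} \<eta>"
proof -
  have L: "L \<ge> 0" using lip by (rule lipschitz_on_nonneg)
  obtain N where N: "N \<in> null_sets lborel"
    and N_speed: "\<And>t. t \<in> {a..b} \<Longrightarrow> t \<notin> N \<Longrightarrow> \<exists>v\<le>c. has_metric_derivative \<eta> {a..b} t v"
    by (rule AE_E3[OF speed]) auto
  have le: "dist (\<eta> x) (\<eta> y) \<le> (c + \<epsilon>) * (y - x) + L * \<epsilon>"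
    if xy: "a \<le> x" "x \<le> y" "y \<le> b" and \<epsilon>: "\<epsilon> > 0" for x y \<epsilon>
  proof -
    obtain U where U: "open U" "N \<subseteq> U" "emeasure lborel (U - N) < ennreal \<epsilon>"
      using outer_regular_lborel[of N "\<epsilon>"] N \<epsilon> by (auto simp: null_sets_def)
    have U_borel: "U \<in> sets lborel" using U(1) by simp
    have "emeasure lborel U = emeasure lborel (U - N)"
      using N U_borel by (simp add: emeasure_Diff_null_set)
    then have U_small: "emeasure lborel U < ennreal \<epsilon>" using U(3) by simp
    have fin: "emeasure lborel (U \<inter> S) \<noteq> \<infinity>" if "S \<in> sets lborel" for S
      using emeasure_mono[of "U \<inter> S" U lborel] U_borel U_small
      by (auto simp: top_unique)
    define \<mu> where "\<mu> S = measure lborel (U \<inter> S)" for S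
    \<comment> \<open>The weighted length \<open>(c + \<epsilon>) * (y - x) + L * \<mu> {x<..y}\<close> is additive in the interval, so
       that it is enough to bound the increments of the curve near every point.\<close>
    have "a \<le> x \<longrightarrow> y \<le> b \<longrightarrow> dist (\<eta> x) (\<eta> y) \<le> (c + \<epsilon>) * (y - x) + L * \<mu> {x<..y}"
      using xy(2)
    proof (induction x y rule: Bolzano)
      case (trans x y z)
      have "\<mu> {x<..z} = \<mu> {x<..y} + \<mu> {y<..z}"
      proof -
        have "U \<inter> {x<..z} = (U \<inter> {x<..y}) \<union> (U \<inter> {y<..z})" using trans by auto
        moreover have "(U \<inter> {x<..y}) \<inter> (U \<inter> {y<..z}) = {}" by auto
        ultimately show ?thesis
          unfolding \<mu>_def using fin U_borel by (simp add: measure_Union)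
      qed
      moreover have "dist (\<eta> x) (\<eta> z) \<le> dist (\<eta> x) (\<eta> y) + dist (\<eta> y) (\<eta> z)"
        by (rule dist_triangle)
      ultimately show ?case using trans by (auto simp: algebra_simps)
    next
      case (local t)
      show ?case
      proof (cases "t \<in> N")
        case True
        then obtain d where d: "d > 0" "ball t d \<subseteq> U"
          using U(1,2) by (meson openE subsetD)
        have "dist (\<eta> u) (\<eta> v) \<le> (c + \<epsilon>) * (v - u) + L * \<mu> {u<..v}"
          if uv: "u \<le> t" "t \<le> v" "v - u < d" "a \<le> u" "v \<le> b" for u v
        proof -
          have "U \<inter> {u<..v} = {u<..v}"
            using d(2) uv by (auto simp: subset_eq dist_real_def)
          then have "\<mu> {u<..v} = v - u" unfolding \<mu>_def using uv by simp
          moreover have "dist (\<eta> u) (\<eta> v) \<le> L * (v - u)"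
            using lipschitz_onD[OF lip, of u v] uv by (simp add: dist_real_def)
          ultimately show ?thesis using \<open>c \<ge> 0\<close> \<epsilon> uv by (simp add: add_increasing)
        qed
        then show ?thesis using d(1) by blast
      next
        case False
        show ?thesis
        proof (cases "t \<in> {a..b}")
          case False
          then show ?thesis by (intro exI[of _ 1]) auto
        next
          case True
          obtain v where "v \<le> c"
            and v: "((\<lambda>s. dist (\<eta> s) (\<eta> t) / \<bar>s - t\<bar>) \<longlongrightarrow> v) (at t within {a..b})"
            using N_speed[OF True False] unfolding has_metric_derivative_def by blast
          have "eventually (\<lambda>s. dist (\<eta> s) (\<eta> t) / \<bar>s - t\<bar> < c + \<epsilon>) (at t within {a..b})"
            using order_tendstoD(2)[OF v, of "c + \<epsilon>"] \<open>v \<le> c\<close> \<epsilon> by linarith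
          then obtain d where d: "d > 0" "\<And>s. s \<in> {a..b} \<Longrightarrow> s \<noteq> t \<Longrightarrow> dist s t < d \<Longrightarrow>
              dist (\<eta> s) (\<eta> t) / \<bar>s - t\<bar> < c + \<epsilon>"
            unfolding eventually_at by blast
          have d': "dist (\<eta> s) (\<eta> t) \<le> (c + \<epsilon>) * \<bar>s - t\<bar>" if "s \<in> {a..b}" "dist s t < d" for s
          proof (cases "s = t")
            case neq: False
            then show ?thesis using d(2)[OF that(1) neq that(2)] by (simp add: field_simps)
          qed simp
          have "dist (\<eta> u) (\<eta> w) \<le> (c + \<epsilon>) * (w - u) + L * \<mu> {u<..w}"
            if uw: "u \<le> t" "t \<le> w" "w - u < d" "a \<le> u" "w \<le> b" for u w
          proof -
            have "dist (\<eta> u) (\<eta> w) \<le> dist (\<eta> u) (\<eta> t) + dist (\<eta> w) (\<eta> t)"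
              by (rule dist_triangle2)
            also have "\<dots> \<le> (c + \<epsilon>) * (t - u) + (c + \<epsilon>) * (w - t)"
              using d'[of u] d'[of w] uw True by (simp add: dist_real_def)
            also have "\<dots> = (c + \<epsilon>) * (w - u)" by (simp add: algebra_simps)
            finally show ?thesis using L by (simp add: \<mu>_def add_increasing2)
          qed
          then show ?thesis using d(1) by blast
        qed
      qed
    qed
    moreover have "\<mu> {x<..y} \<le> \<epsilon>"
    proof -
      have "emeasure lborel (U \<inter> {x<..y}) \<le> emeasure lborel U"
        using U_borel by (intro emeasure_mono) auto
      also have "\<dots> \<le> ennreal \<epsilon>" using U_small by simp
      finally show ?thesis unfolding \<mu>_def using \<epsilon> by (simp add: measure_def enn2real_leI)
    qed
    ultimately show ?thesis using xy L mult_left_mono[of "\<mu> {x<..y}" \<epsilon> L] by linarith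
  qed
  have le': "dist (\<eta> x) (\<eta> y) \<le> c * (y - x)" if xy: "a \<le> x" "x \<le> y" "y \<le> b" for x y
  proof (rule field_le_epsilon)
    fix e :: real assume e: "e > 0"
    let ?C = "y - x + L + 1"
    have C: "?C > 0" using xy L by simp
    have "dist (\<eta> x) (\<eta> y) \<le> (c + e / ?C) * (y - x) + L * (e / ?C)"
      using le[OF xy, of "e / ?C"] e C by simp
    also have "\<dots> = c * (y - x) + e * ((y - x + L) / ?C)"
      by (simp add: algebra_simps flip: add_divide_distrib)
    also have "(y - x + L) / ?C \<le> 1" using C by simp
    finally show "dist (\<eta> x) (\<eta> y) \<le> c * (y - x) + e" using e by simp
  qed
  show ?thesis
  proof (rule lipschitz_onI[OF _ \<open>c \<ge> 0\<close>])
    fix x y assume "x \<in> {a..b}" "y \<in> {a..b}"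
    then show "dist (\<eta> x) (\<eta> y) \<le> c * dist x y"
      using le'[of x y] le'[of y x] by (cases "x \<le> y") (auto simp: dist_real_def dist_commute)
  qed
qed

section \<open>Exit times of optimal curves\<close>

text \<open>
  For a closed target the infimum is a minimum, so that the exit point lies in \<open>\<Gamma>\<close>; this is needed to
  use the Lipschitz bound on \<open>g\<close>, which holds on \<open>\<Gamma>\<close> only.
\<close>

lemma exit_time_attained:
  fixes \<gamma> :: "real \<Rightarrow> 'a::metric_space"
  assumes "closed \<Gamma>" and cont: "continuous_on {0..} \<gamma>" and "t\<^sub>0 \<ge> 0" "u \<ge> 0" "\<gamma> (u + t\<^sub>0) \<in> \<Gamma>"
  obtains \<sigma> where "0 \<le> \<sigma>" "\<sigma> \<le> u" "\<gamma> (\<sigma> + t\<^sub>0) \<in> \<Gamma>" "exit_time \<Gamma> t\<^sub>0 \<gamma> = ereal \<sigma>"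
proof -
  let ?S = "{0..u} \<inter> (\<lambda>t. \<gamma> (t + t\<^sub>0)) -` \<Gamma>"
  have "continuous_on {0..u} (\<lambda>t. \<gamma> (t + t\<^sub>0))"
    using \<open>t\<^sub>0 \<ge> 0\<close> by (intro continuous_on_compose2[OF cont] continuous_intros) auto
  then have "closed ?S"
    using \<open>closed \<Gamma>\<close> by (intro continuous_closed_preimage) auto
  then have "compact ({0..u} \<inter> ?S)" by (rule compact_Int_closed[OF compact_Icc])
  then have "compact ?S" by (simp flip: Int_assoc)
  moreover have "u \<in> ?S" using assms by auto
  ultimately obtain \<sigma> where \<sigma>: "\<sigma> \<in> ?S" "\<forall>t\<in>?S. \<sigma> \<le> t"
    using compact_attains_inf[of ?S] by blast
  have "exit_time \<Gamma> t\<^sub>0 \<gamma> = ereal \<sigma>"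
    unfolding exit_time_def
  proof (rule cInf_eq_minimum)
    show "ereal \<sigma> \<in> {ereal t |t. 0 \<le> t \<and> \<gamma> (t + t\<^sub>0) \<in> \<Gamma>}" using \<sigma>(1) by auto
    fix s assume "s \<in> {ereal t |t. 0 \<le> t \<and> \<gamma> (t + t\<^sub>0) \<in> \<Gamma>}"
    then obtain t where t: "s = ereal t" "0 \<le> t" "\<gamma> (t + t\<^sub>0) \<in> \<Gamma>" by blast
    then show "ereal \<sigma> \<le> s" using \<sigma> by (cases "t \<le> u") auto
  qed
  then show ?thesis using that \<sigma>(1) by auto
qed

text \<open>
  Running along a unit-speed curve at speed \<open>c\<close> and then stopping at its end point is admissible
  as soon as \<open>c\<close> is a lower bound of the maximal speed \<open>k\<close>. Null sets of times are preserved by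
  \<open>t \<mapsto> c * t\<close>, so the speed is \<open>c\<close> at almost every time before the stop and \<open>0\<close> after it.
\<close>

lemma constant_speed_curve_admissible:
  fixes \<eta> :: "real \<Rightarrow> 'a::metric_space"
  assumes "T \<ge> 0" and lip: "1-lipschitz_on {0..T} \<eta>"
    and speed: "AE t in lborel. t \<in> {0..T} \<longrightarrow> has_metric_derivative \<eta> {0..T} t 1"
    and "c > 0" and k: "\<And>t x. t \<ge> 0 \<Longrightarrow> c \<le> k t x"
  shows "restrict (\<lambda>t. \<eta> (min (c * t) T)) {0..} \<in> admissible k"
proof -
  define \<beta> where "\<beta> = restrict (\<lambda>t. \<eta> (min (c * t) T)) {0..}"
  have \<beta>: "\<beta> t = \<eta> (min (c * t) T)" if "t \<ge> 0" for t using that by (simp add: \<beta>_def)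
  have "c-lipschitz_on {0..} \<beta>"
  proof (rule lipschitz_onI)
    fix s t :: real assume st: "s \<in> {0..}" "t \<in> {0..}"
    have "dist (\<beta> s) (\<beta> t) \<le> 1 * dist (min (c * s) T) (min (c * t) T)"
      unfolding \<beta>[OF st(1)[unfolded atLeast_iff]] \<beta>[OF st(2)[unfolded atLeast_iff]]
      using st \<open>T \<ge> 0\<close> \<open>c > 0\<close> by (intro lipschitz_onD[OF lip]) auto
    also have "\<dots> \<le> \<bar>c * s - c * t\<bar>" by (auto simp: dist_real_def min_def)
    also have "\<dots> = c * dist s t"
      using \<open>c > 0\<close> by (simp add: dist_real_def abs_mult flip: right_diff_distrib)
    finally show "dist (\<beta> s) (\<beta> t) \<le> c * dist s t" .
  qed (use \<open>c > 0\<close> in simp)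
  then have lips: "\<beta> \<in> lipschitz_curves" by (auto simp: lipschitz_curves_def \<beta>_def)
  obtain N where N: "N \<in> null_sets lborel"
    and N_speed: "\<And>t. t \<in> {0..T} \<Longrightarrow> t \<notin> N \<Longrightarrow> has_metric_derivative \<eta> {0..T} t 1"
    by (rule AE_E3[OF speed]) auto
  have N_borel: "N \<in> sets borel" using N by auto
  have "AE t in lborel. 0 + c * t \<notin> N"
    using \<open>c > 0\<close> N N_borel by (intro AE_borel_affine AE_not_in) auto
  moreover have "AE t in lborel. t \<noteq> (0::real)" "AE t in lborel. t \<noteq> T / c"
    by (rule AE_lborel_singleton)+
  ultimately have
    "AE t in lborel. t \<ge> 0 \<longrightarrow> (\<exists>v. has_metric_derivative \<beta> {0..} t v \<and> v \<le> k t (\<beta> t))"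
  proof eventually_elim
    case (elim t)
    show ?case
    proof
      assume "t \<ge> 0"
      then have "t > 0" using elim by simp
      have "\<exists>v\<le>c. has_metric_derivative \<beta> {0..} t v"
      proof (cases "c * t < T")
        case True
        have pos: "c * t > 0" using \<open>t > 0\<close> \<open>c > 0\<close> by simp
        have "((\<lambda>u. dist (\<eta> u) (\<eta> (c * t)) / \<bar>u - c * t\<bar>) \<longlongrightarrow> 1) (at (c * t))"
          using N_speed[of "c * t"] elim(1) True pos
          by (simp add: has_metric_derivative_def at_within_Icc_at)
        moreover have "filterlim (\<lambda>s. c * s) (at (c * t)) (at t)"
          unfolding filterlim_at using \<open>c > 0\<close>
          by (auto intro!: tendsto_intros simp: eventually_at_filter)
        ultimately have "((\<lambda>s. dist (\<eta> (c * s)) (\<eta> (c * t)) / \<bar>c * s - c * t\<bar>) \<longlongrightarrow> 1) (at t)"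
          by (rule filterlim_compose)
        then have lim: "((\<lambda>s. c * (dist (\<eta> (c * s)) (\<eta> (c * t)) / \<bar>c * s - c * t\<bar>)) \<longlongrightarrow> c * 1) (at t)"
          by (intro tendsto_intros)
        have "eventually (\<lambda>s. s \<in> {0<..<T / c}) (at t)"
          using True \<open>t > 0\<close> \<open>c > 0\<close> by (intro eventually_at_in_open') (auto simp: field_simps)
        then have "eventually (\<lambda>s. c * (dist (\<eta> (c * s)) (\<eta> (c * t)) / \<bar>c * s - c * t\<bar>)
            = dist (\<beta> s) (\<beta> t) / \<bar>s - t\<bar>) (at t)"
        proof eventually_elim
          case (elim s)
          then have "\<beta> s = \<eta> (c * s)" using \<open>c > 0\<close> by (simp add: \<beta> min_def field_simps)
          moreover have "\<beta> t = \<eta> (c * t)" using True \<open>t > 0\<close> by (simp add: \<beta>)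
          moreover have "\<bar>c * s - c * t\<bar> = c * \<bar>s - t\<bar>"
            using \<open>c > 0\<close> by (simp add: abs_mult flip: right_diff_distrib)
          ultimately show ?case using \<open>c > 0\<close> by simp
        qed
        then have "((\<lambda>s. dist (\<beta> s) (\<beta> t) / \<bar>s - t\<bar>) \<longlongrightarrow> c) (at t)"
          using lim by (simp add: tendsto_cong)
        then show ?thesis
          unfolding has_metric_derivative_def by (blast intro: tendsto_within_subset)
      next
        case False
        then have t: "t > T / c" using elim(3) \<open>c > 0\<close> by (simp add: field_simps)
        then have "eventually (\<lambda>s. s \<in> {T / c<..}) (at t)"
          by (intro eventually_at_in_open') auto
        then have "eventually (\<lambda>s. 0 = dist (\<beta> s) (\<beta> t) / \<bar>s - t\<bar>) (at t)"
        proof eventually_elim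
          case (elim s)
          have "0 \<le> T / c" using \<open>T \<ge> 0\<close> \<open>c > 0\<close> by simp
          then have "s \<ge> 0" using elim by simp
          then show ?case using elim t \<open>t > 0\<close> \<open>c > 0\<close> by (simp add: \<beta> min_def field_simps)
        qed
        then have "((\<lambda>s. dist (\<beta> s) (\<beta> t) / \<bar>s - t\<bar>) \<longlongrightarrow> 0) (at t)"
          by (rule Lim_transform_eventually[OF tendsto_const])
        then show ?thesis
          unfolding has_metric_derivative_def using \<open>c > 0\<close>
          by (intro exI[of _ 0]) (auto intro: tendsto_within_subset)
      qed
      then show "\<exists>v. has_metric_derivative \<beta> {0..} t v \<and> v \<le> k t (\<beta> t)"
        using k[OF \<open>t \<ge> 0\<close>, of "\<beta> t"] by force
    qed
  qed
  then show ?thesis using lips unfolding admissible_def \<beta>_def by simp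
qed

text \<open>
  An optimal curve is compared with the competitor that runs from \<open>x\<close> to the fixed point \<open>z \<in> \<Gamma>\<close>
  at speed \<open>c\<close> along a curve of length \<open>T \<le> D * dist x z\<close>. The competitor leaves no later than
  \<open>T / c\<close>, at a point within distance \<open>T\<close> of \<open>z\<close>, so that its exit cost is at most
  \<open>g z + Lg * T\<close>. As \<open>g\<close> is nonnegative, the total bounds the exit time of the optimal curve,
  and the curve rests from then on. The bound depends on the
  dynamics only through the lower speed bound \<open>c\<close>.
\<close>

lemma optimal_curve_eventually_constant:
  fixes \<Gamma> :: "'a::metric_space set"
  assumes "closed \<Gamma>" "z \<in> \<Gamma>"
    and g: "\<And>x. x \<in> \<Gamma> \<Longrightarrow> g x \<ge> 0" "Lg-lipschitz_on \<Gamma> g"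
    and D: "\<And>x y :: 'a. \<exists>T\<in>{0..D * dist x y}. \<exists>\<gamma>.
          (\<exists>L. L-lipschitz_on {0..T} \<gamma>) \<and> \<gamma> 0 = x \<and> \<gamma> T = y \<and>
          (AE t in lborel. t \<in> {0..T} \<longrightarrow> has_metric_derivative \<gamma> {0..T} t 1)"
    and "c > 0" and k: "\<And>t x. t \<ge> 0 \<Longrightarrow> c \<le> k t x"
    and opt: "\<gamma> \<in> optimal_curves \<Gamma> k g 0 x"
    and t: "t \<ge> (1 / c + Lg) * (D * dist x z) + g z"
    and s: "s \<ge> (1 / c + Lg) * (D * dist x z) + g z"
  shows "\<gamma> s = \<gamma> t"
proof -
  have Lg: "Lg \<ge> 0" using g(2) by (rule lipschitz_on_nonneg)
  obtain T \<eta> L where T: "T \<in> {0..D * dist x z}" and \<eta>_lip: "L-lipschitz_on {0..T} \<eta>"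
    and ends: "\<eta> 0 = x" "\<eta> T = z"
    and speed: "AE t in lborel. t \<in> {0..T} \<longrightarrow> has_metric_derivative \<eta> {0..T} t 1"
    using D[of x z] by blast
  have "AE t in lborel. t \<in> {0..T} \<longrightarrow> (\<exists>v\<le>1. has_metric_derivative \<eta> {0..T} t v)"
    using speed by eventually_elim (use order_refl in blast)
  then have lip: "1-lipschitz_on {0..T} \<eta>"
    by (intro lipschitz_on_metric_speed_le[OF \<eta>_lip]) simp_all
  define \<beta> where "\<beta> = restrict (\<lambda>t. \<eta> (min (c * t) T)) {0..}"
  have \<beta>_adm: "\<beta> \<in> admissible k"
    unfolding \<beta>_def using T lip speed \<open>c > 0\<close> k by (intro constant_speed_curve_admissible) auto
  have \<beta>: "\<beta> t = \<eta> (min (c * t) T)" if "t \<ge> 0" for t using that by (simp add: \<beta>_def)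
  have cont: "continuous_on {0..} \<beta>"
    using \<beta>_adm by (auto simp: admissible_def lipschitz_curves_def intro: lipschitz_on_continuous_on)
  have "T / c \<ge> 0" "\<beta> (T / c + 0) \<in> \<Gamma>"
    using T \<open>c > 0\<close> ends \<open>z \<in> \<Gamma>\<close> by (auto simp: \<beta>)
  then obtain \<sigma> where \<sigma>: "0 \<le> \<sigma>" "\<sigma> \<le> T / c" "\<beta> \<sigma> \<in> \<Gamma>" "exit_time \<Gamma> 0 \<beta> = ereal \<sigma>"
    using exit_time_attained[OF \<open>closed \<Gamma>\<close> cont, of 0 "T / c"] by auto
  have "c * \<sigma> \<le> T" using \<sigma>(2) \<open>c > 0\<close> by (simp add: field_simps)
  then have \<beta>\<sigma>: "\<beta> \<sigma> = \<eta> (c * \<sigma>)" using \<sigma>(1) by (simp add: \<beta>)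
  have "g (\<beta> \<sigma>) \<le> g z + Lg * dist (\<beta> \<sigma>) z"
    using lipschitz_onD[OF g(2) \<sigma>(3) \<open>z \<in> \<Gamma>\<close>] by (simp add: dist_real_def)
  also have "dist (\<beta> \<sigma>) z \<le> T"
  proof -
    have "dist (\<eta> (c * \<sigma>)) (\<eta> T) \<le> 1 * dist (c * \<sigma>) T"
      using \<open>c * \<sigma> \<le> T\<close> \<sigma>(1) \<open>c > 0\<close> T by (intro lipschitz_onD[OF lip]) auto
    also have "\<dots> \<le> T" using \<open>c * \<sigma> \<le> T\<close> \<sigma>(1) \<open>c > 0\<close> by (simp add: dist_real_def)
    finally show ?thesis by (simp add: \<beta>\<sigma> ends)
  qed
  finally have g\<sigma>: "g (\<beta> \<sigma>) \<le> g z + Lg * T" using Lg by (simp add: mult_left_mono)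
  define \<tau> where "\<tau> = real_of_ereal (exit_time \<Gamma> 0 \<gamma>)"
  have "exit_time \<Gamma> 0 \<gamma> \<ge> 0"
    unfolding exit_time_def by (rule Inf_greatest) auto
  moreover have fin: "exit_time \<Gamma> 0 \<gamma> < \<infinity>"
    using opt unfolding optimal_curves_def by blast
  ultimately have \<tau>: "exit_time \<Gamma> 0 \<gamma> = ereal \<tau>"
    unfolding \<tau>_def by (cases "exit_time \<Gamma> 0 \<gamma>") auto
  have "let T = 0 + \<tau> in \<gamma> T \<in> \<Gamma> \<and> (\<forall>t\<ge>T. \<gamma> t = \<gamma> T)"
    using opt unfolding optimal_curves_def \<tau>_def by blast
  then have stop: "\<gamma> \<tau> \<in> \<Gamma>" "\<And>t. t \<ge> \<tau> \<Longrightarrow> \<gamma> t = \<gamma> \<tau>"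
    unfolding Let_def add_0 by blast+
  have "\<beta> 0 = x" using T by (simp add: \<beta> ends)
  then have "exit_time \<Gamma> 0 \<gamma> + exit_cost \<Gamma> g 0 \<gamma> \<le> exit_time \<Gamma> 0 \<beta> + exit_cost \<Gamma> g 0 \<beta>"
    using opt \<beta>_adm unfolding optimal_curves_def by blast
  then have "\<tau> + g (\<gamma> \<tau>) \<le> \<sigma> + g (\<beta> \<sigma>)"
    by (simp add: exit_cost_def \<tau> \<sigma>(4))
  then have "\<tau> \<le> T / c + g z + Lg * T" using g(1)[OF stop(1)] g\<sigma> \<sigma>(2) by linarith
  also have "\<dots> = (1 / c + Lg) * T + g z" by (simp add: algebra_simps)
  also have "\<dots> \<le> (1 / c + Lg) * (D * dist x z) + g z"
    using T Lg \<open>c > 0\<close> by (intro add_right_mono mult_left_mono) auto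
  finally show ?thesis using stop(2)[OF order_trans[OF _ s]] stop(2)[OF order_trans[OF _ t]] by simp
qed

section \<open>Measurability on the path space\<close>

lemma openin_curve_topologyI:
  assumes "U \<subseteq> curves"
    and nbhd: "\<And>\<gamma>. \<gamma> \<in> U \<Longrightarrow> \<exists>C \<epsilon>. compact C \<and> C \<subseteq> {0..} \<and> \<epsilon> > 0 \<and>
      {\<beta> \<in> curves. \<forall>t\<in>C. dist (\<beta> t) (\<gamma> t) < \<epsilon>} \<subseteq> U"
  shows "openin curve_topology U"
proof (subst openin_subopen, intro ballI)
  fix \<gamma> assume \<gamma>: "\<gamma> \<in> U"
  obtain C \<epsilon> where C: "compact C" "C \<subseteq> {0..}" "\<epsilon> > 0"
    "{\<beta> \<in> curves. \<forall>t\<in>C. dist (\<beta> t) (\<gamma> t) < \<epsilon>} \<subseteq> U"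
    using nbhd[OF \<gamma>] by (elim exE conjE)
  have "\<gamma> \<in> curves" using \<gamma> \<open>U \<subseteq> curves\<close> by blast
  have "openin curve_topology {\<beta> \<in> curves. \<forall>t\<in>C. dist (\<beta> t) (\<gamma> t) < \<epsilon>}" (is "openin _ ?V")
    unfolding curve_topology_def using C \<open>\<gamma> \<in> curves\<close>
    by (intro topology_generated_by_Basis CollectI exI[of _ \<gamma>] exI[of _ C] exI[of _ \<epsilon>] conjI refl)
  then show "\<exists>T. openin curve_topology T \<and> \<gamma> \<in> T \<and> T \<subseteq> U"
    using C(3,4) \<open>\<gamma> \<in> curves\<close> by (intro exI[of _ ?V] conjI CollectI ballI) simp_all
qed

lemma space_curve_borel [simp]: "space curve_borel = curves"
  by (simp add: curve_borel_def space_measure_of_conv)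

lemma open_in_curve_borel:
  assumes "openin curve_topology U"
  shows "U \<in> sets (curve_borel :: (real \<Rightarrow> 'a::metric_space) measure)"
proof -
  have "topspace (curve_topology :: (real \<Rightarrow> 'a) topology) \<subseteq> curves"
    by (auto simp: curve_topology_def)
  then have "{U. openin curve_topology U} \<subseteq> Pow (curves :: (real \<Rightarrow> 'a) set)"
    using openin_subset by blast
  then show ?thesis using assms unfolding curve_borel_def by (simp add: sigma_sets.Basic)
qed

text \<open>
  Joint measurability is proved from joint continuity: the space is not assumed to be second
  countable as a type, and then the Borel sigma-algebra of the product need not be generated by
  measurable rectangles, so measurability of the two components would not suffice.
\<close>

lemma evaluation_pair_measurable:
  fixes s t :: real
  assumes "s \<ge> 0" "t \<ge> 0"
  shows "(\<lambda>\<gamma>. (\<gamma> s, \<gamma> t)) \<in> curve_borel \<rightarrow>\<^sub>M (borel :: ('a::metric_space \<times> 'a) measure)"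
proof (rule borel_measurableI)
  fix U :: "('a \<times> 'a) set" assume "open U"
  have "openin curve_topology ((\<lambda>\<gamma>. (\<gamma> s, \<gamma> t)) -` U \<inter> curves)"
  proof (rule openin_curve_topologyI)
    fix \<gamma> :: "real \<Rightarrow> 'a" assume "\<gamma> \<in> (\<lambda>\<gamma>. (\<gamma> s, \<gamma> t)) -` U \<inter> curves"
    then have "(\<gamma> s, \<gamma> t) \<in> U" by simp
    then obtain A B where AB: "open A" "open B" "\<gamma> s \<in> A" "\<gamma> t \<in> B" "A \<times> B \<subseteq> U"
      by (rule open_prod_elim[OF \<open>open U\<close>]) auto
    obtain d where d: "d > 0" "ball (\<gamma> s) d \<subseteq> A"
      using openE[OF AB(1,3)] by blast
    obtain e where e: "e > 0" "ball (\<gamma> t) e \<subseteq> B"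
      using openE[OF AB(2,4)] by blast
    have "{\<beta> \<in> curves. \<forall>r\<in>{s, t}. dist (\<beta> r) (\<gamma> r) < min d e} \<subseteq> (\<lambda>\<gamma>. (\<gamma> s, \<gamma> t)) -` U \<inter> curves"
    proof
      fix \<beta> assume "\<beta> \<in> {\<beta> \<in> curves. \<forall>r\<in>{s, t}. dist (\<beta> r) (\<gamma> r) < min d e}"
      then have "\<beta> \<in> curves" "\<beta> s \<in> ball (\<gamma> s) d" "\<beta> t \<in> ball (\<gamma> t) e"
        by (simp_all add: dist_commute)
      then show "\<beta> \<in> (\<lambda>\<gamma>. (\<gamma> s, \<gamma> t)) -` U \<inter> curves"
        using d(2) e(2) AB(5) by blast
    qed
    moreover have "compact {s, t}" "{s, t} \<subseteq> {0..}" "min d e > 0"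
      using assms d(1) e(1) by simp_all
    ultimately show "\<exists>C \<epsilon>. compact C \<and> C \<subseteq> {0..} \<and> \<epsilon> > 0 \<and>
        {\<beta> \<in> curves. \<forall>r\<in>C. dist (\<beta> r) (\<gamma> r) < \<epsilon>} \<subseteq> (\<lambda>\<gamma>. (\<gamma> s, \<gamma> t)) -` U \<inter> curves"
      by blast
  qed simp
  then show "(\<lambda>\<gamma>. (\<gamma> s, \<gamma> t)) -` U \<inter> space curve_borel \<in> sets curve_borel"
    by (simp add: open_in_curve_borel)
qed

lemma evaluation_measurable:
  "(\<lambda>\<gamma>. \<gamma> t) \<in> curve_borel \<rightarrow>\<^sub>M (borel :: 'a::metric_space measure)"
proof (cases "t \<ge> 0")
  case True
  have "fst \<circ> (\<lambda>\<gamma>. (\<gamma> t, \<gamma> t)) \<in> curve_borel \<rightarrow>\<^sub>M (borel :: 'a measure)"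
    by (rule measurable_comp[OF evaluation_pair_measurable[OF True True]])
       (rule borel_measurable_continuous_onI[OF continuous_on_fst[OF continuous_on_id]])
  then show ?thesis by (simp add: comp_def)
next
  case False
  then have "\<gamma> t = undefined" if "\<gamma> \<in> space curve_borel" for \<gamma> :: "real \<Rightarrow> 'a"
    using that by (auto simp: curves_def extensional_def)
  then have "(\<lambda>\<gamma>. \<gamma> t) \<in> curve_borel \<rightarrow>\<^sub>M (borel :: 'a measure) \<longleftrightarrow>
      (\<lambda>\<gamma>. undefined) \<in> (curve_borel :: (real \<Rightarrow> 'a) measure) \<rightarrow>\<^sub>M (borel :: 'a measure)"
    by (rule measurable_cong)
  then show ?thesis by simp
qed

lemma complete_of_compact_cballs:
  fixes origin :: "'a::metric_space"
  assumes "\<And>R. R > 0 \<Longrightarrow> compact (cball origin R)"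
  shows "uniform_space_class.complete (UNIV :: 'a set)"
proof (rule completeI)
  fix u :: "nat \<Rightarrow> 'a" assume "Cauchy u"
  then have "bounded (range u)" by (rule cauchy_imp_bounded)
  then obtain R where R: "\<And>n. dist origin (u n) \<le> R"
    unfolding bounded_any_center[where a = origin] by auto
  have "0 \<le> R" using R[of 0] zero_le_dist order_trans by blast
  have "uniform_space_class.complete (cball origin (R + 1))"
    using \<open>0 \<le> R\<close> by (intro compact_imp_complete assms) simp
  moreover have "\<forall>n. u n \<in> cball origin (R + 1)" using R by (simp add: add_increasing2)
  ultimately show "\<exists>l\<in>UNIV. u \<longlonglongrightarrow> l" using \<open>Cauchy u\<close> unfolding complete_def by blast
qed

text \<open>
  This expresses convergence through countably many conditions, each of which is closed in the
  topology of uniform convergence on compact sets.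
\<close>

lemma convergent_at_top_iff_Cauchy:
  fixes \<gamma> :: "real \<Rightarrow> 'a::metric_space"
  assumes "uniform_space_class.complete (UNIV :: 'a set)"
  shows "(\<exists>x. (\<gamma> \<longlongrightarrow> x) at_top) \<longleftrightarrow>
    (\<forall>n::nat. \<exists>N::nat. \<forall>s\<ge>real N. \<forall>t\<ge>real N. dist (\<gamma> s) (\<gamma> t) \<le> 1 / real (Suc n))"
    (is "?L \<longleftrightarrow> ?R")
proof
  assume ?L
  then obtain x where x: "(\<gamma> \<longlongrightarrow> x) at_top" by blast
  show ?R
  proof
    fix n
    have "eventually (\<lambda>t. dist (\<gamma> t) x < 1 / real (Suc n) / 2) at_top"
      using x by (rule tendstoD) simp
    then obtain b where b: "\<And>t. t \<ge> b \<Longrightarrow> dist (\<gamma> t) x < 1 / real (Suc n) / 2"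
      by (auto simp: eventually_at_top_linorder)
    obtain N :: nat where "b \<le> real N" using real_arch_simple by blast
    then have "dist (\<gamma> s) (\<gamma> t) \<le> 1 / real (Suc n)" if "s \<ge> real N" "t \<ge> real N" for s t
      using b[of s] b[of t] that dist_triangle2[of "\<gamma> s" "\<gamma> t" x] by linarith
    then show "\<exists>N::nat. \<forall>s\<ge>real N. \<forall>t\<ge>real N. dist (\<gamma> s) (\<gamma> t) \<le> 1 / real (Suc n)"
      by blast
  qed
next
  assume R: ?R
  have "Cauchy (\<lambda>n. \<gamma> (real n))"
  proof (rule metric_CauchyI)
    fix e :: real assume "e > 0"
    then obtain n where n: "1 / real (Suc n) < e" using nat_approx_posE by blast
    obtain N where "\<forall>s\<ge>real N. \<forall>t\<ge>real N. dist (\<gamma> s) (\<gamma> t) \<le> 1 / real (Suc n)"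
      using R by blast
    then show "\<exists>M. \<forall>m\<ge>M. \<forall>k\<ge>M. dist (\<gamma> (real m)) (\<gamma> (real k)) < e"
      using le_less_trans[OF _ n] by (metis of_nat_le_iff)
  qed
  then obtain x where x: "(\<lambda>n. \<gamma> (real n)) \<longlonglongrightarrow> x"
    using assms unfolding complete_def by blast
  have "(\<gamma> \<longlongrightarrow> x) at_top"
  proof (rule tendstoI)
    fix e :: real assume "e > 0"
    then have "e / 2 > 0" by simp
    then obtain n where n: "1 / real (Suc n) < e / 2" using nat_approx_posE by blast
    obtain N where N: "\<forall>s\<ge>real N. \<forall>t\<ge>real N. dist (\<gamma> s) (\<gamma> t) \<le> 1 / real (Suc n)"
      using R by blast
    have "eventually (\<lambda>m. dist (\<gamma> (real m)) x < e / 2) sequentially"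
      using x \<open>e / 2 > 0\<close> by (rule tendstoD)
    then obtain m where m: "m \<ge> N" "dist (\<gamma> (real m)) x < e / 2"
      unfolding eventually_sequentially using max.cobounded1 max.cobounded2 by metis
    have "dist (\<gamma> t) x < e" if "t \<ge> real N" for t
    proof -
      have "dist (\<gamma> t) (\<gamma> (real m)) \<le> 1 / real (Suc n)" using N that m(1) by simp
      then show ?thesis using n m(2) dist_triangle[of "\<gamma> t" x "\<gamma> (real m)"] by linarith
    qed
    then show "eventually (\<lambda>t. dist (\<gamma> t) x < e) at_top"
      unfolding eventually_at_top_linorder by blast
  qed
  then show ?L by blast
qed

lemma convergent_curves_measurable:
  assumes "uniform_space_class.complete (UNIV :: 'a::metric_space set)"
  shows "(convergent_curves :: (real \<Rightarrow> 'a) set) \<in> sets curve_borel"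
proof -
  define F :: "nat \<Rightarrow> nat \<Rightarrow> (real \<Rightarrow> 'a) set" where
    "F n N = {\<gamma> \<in> curves. \<exists>s\<ge>real N. \<exists>t\<ge>real N. dist (\<gamma> s) (\<gamma> t) > 1 / real (Suc n)}" for n N
  have "openin curve_topology (F n N)" for n N
  proof (rule openin_curve_topologyI)
    fix \<gamma> assume "\<gamma> \<in> F n N"
    then obtain s t where st: "s \<ge> real N" "t \<ge> real N" "dist (\<gamma> s) (\<gamma> t) > 1 / real (Suc n)"
      unfolding F_def by blast
    define \<epsilon> where "\<epsilon> = (dist (\<gamma> s) (\<gamma> t) - 1 / real (Suc n)) / 2"
    have "dist (\<beta> s) (\<beta> t) > 1 / real (Suc n)"
      if "dist (\<beta> s) (\<gamma> s) < \<epsilon>" "dist (\<beta> t) (\<gamma> t) < \<epsilon>" for \<beta>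
      using that dist_triangle[of "\<gamma> s" "\<gamma> t" "\<beta> s"] dist_triangle[of "\<beta> s" "\<gamma> t" "\<beta> t"]
      unfolding \<epsilon>_def by (simp add: dist_commute)
    then have "{\<beta> \<in> curves. \<forall>r\<in>{s, t}. dist (\<beta> r) (\<gamma> r) < \<epsilon>} \<subseteq> F n N"
      unfolding F_def using st by blast
    moreover have "\<epsilon> > 0" "{s, t} \<subseteq> {0..}" using st by (auto simp: \<epsilon>_def)
    ultimately show "\<exists>C \<epsilon>. compact C \<and> C \<subseteq> {0..} \<and> \<epsilon> > 0 \<and>
        {\<beta> \<in> curves. \<forall>r\<in>C. dist (\<beta> r) (\<gamma> r) < \<epsilon>} \<subseteq> F n N"
      by (intro exI[of _ "{s, t}"] exI[of _ \<epsilon>]) simp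
  qed (auto simp: F_def)
  then have F_sets: "F n N \<in> sets curve_borel" for n N by (rule open_in_curve_borel)
  have eq: "convergent_curves = curves \<inter> (\<Inter>n. \<Union>N. curves - F n N)"
  proof -
    have F: "curves - F n N =
        {\<gamma> \<in> curves. \<forall>s\<ge>real N. \<forall>t\<ge>real N. dist (\<gamma> s) (\<gamma> t) \<le> 1 / real (Suc n)}" for n N
      unfolding F_def not_less[symmetric] by blast
    show ?thesis
      unfolding convergent_curves_def convergent_at_top_iff_Cauchy[OF assms] F by blast
  qed
  have curves_sets: "curves \<in> sets (curve_borel :: (real \<Rightarrow> 'a) measure)"
    using sets.top[of curve_borel] by simp
  have "(\<Inter>n. \<Union>N. curves - F n N) \<in> sets curve_borel"
    by (intro sets.countable_INT' sets.countable_UN' image_subsetI sets.Diff curves_sets F_sets) auto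
  then show ?thesis unfolding eq by (rule sets.Int[OF curves_sets])
qed

text \<open>
  The value at time \<open>0\<close> serves as default for curves without a limit, because it keeps the map
  a pointwise limit of measurable evaluations on the whole path space.
\<close>

definition terminal_point :: "(real \<Rightarrow> 'a::metric_space) \<Rightarrow> 'a" where
  "terminal_point \<gamma> = (if \<gamma> \<in> convergent_curves then Lim at_top \<gamma> else \<gamma> 0)"

lemma tendsto_terminal_point:
  assumes "\<gamma> \<in> convergent_curves"
  shows "(\<gamma> \<longlongrightarrow> terminal_point \<gamma>) at_top"
  using assms by (auto simp: terminal_point_def convergent_curves_def tendsto_Lim)

lemma terminal_pair_measurable:
  fixes t :: real
  assumes "uniform_space_class.complete (UNIV :: 'a::metric_space set)" "t \<ge> 0"
  shows "(\<lambda>\<gamma>. (\<gamma> t, terminal_point \<gamma>)) \<in> curve_borel \<rightarrow>\<^sub>M (borel :: ('a \<times> 'a) measure)"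
proof (rule borel_measurable_LIMSEQ_metric)
  fix n :: nat
  show "(\<lambda>\<gamma>. if \<gamma> \<in> convergent_curves then (\<gamma> t, \<gamma> (real n)) else (\<gamma> t, \<gamma> 0))
      \<in> curve_borel \<rightarrow>\<^sub>M (borel :: ('a \<times> 'a) measure)"
    using assms convergent_curves_measurable[OF assms(1)]
    by (intro measurable_If_set evaluation_pair_measurable sets.Int sets.top) auto
next
  fix \<gamma> :: "real \<Rightarrow> 'a"
  show "(\<lambda>n. if \<gamma> \<in> convergent_curves then (\<gamma> t, \<gamma> (real n)) else (\<gamma> t, \<gamma> 0))
      \<longlonglongrightarrow> (\<gamma> t, terminal_point \<gamma>)"
  proof (cases "\<gamma> \<in> convergent_curves")
    case True
    have "(\<lambda>n. \<gamma> (real n)) \<longlonglongrightarrow> terminal_point \<gamma>"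
      by (rule filterlim_compose[OF tendsto_terminal_point[OF True] filterlim_real_sequentially])
    then show ?thesis using True by (simp add: tendsto_Pair)
  qed (simp add: terminal_point_def)
qed

lemma terminal_point_measurable:
  assumes "uniform_space_class.complete (UNIV :: 'a::metric_space set)"
  shows "terminal_point \<in> curve_borel \<rightarrow>\<^sub>M (borel :: 'a measure)"
proof -
  have "snd \<circ> (\<lambda>\<gamma>. (\<gamma> 0, terminal_point \<gamma>)) \<in> curve_borel \<rightarrow>\<^sub>M (borel :: 'a measure)"
    by (rule measurable_comp[OF terminal_pair_measurable[OF assms order_refl]])
       (rule borel_measurable_continuous_onI[OF continuous_on_snd[OF continuous_on_id]])
  then show ?thesis by (simp add: comp_def)
qed

text \<open>
  Once almost every curve converges, the law of the limit can be computed on the unrestricted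
  path space, where it can be compared with the marginals at finite times.
\<close>

lemma marginal_at_infinity_eq_distr:
  fixes Q :: "(real \<Rightarrow> 'a::metric_space) measure"
  assumes "uniform_space_class.complete (UNIV :: 'a set)" and sets_Q: "sets Q = sets curve_borel"
    and conv: "AE \<gamma> in Q. \<gamma> \<in> convergent_curves"
  shows "marginal_at_infinity Q = distr Q borel terminal_point"
proof (rule measure_eqI)
  show "sets (marginal_at_infinity Q) = sets (distr Q borel terminal_point)"
    by (simp add: marginal_at_infinity_def)
  fix A assume "A \<in> sets (marginal_at_infinity Q)"
  then have A: "A \<in> sets borel" by (simp add: marginal_at_infinity_def)
  have e[measurable]: "terminal_point \<in> Q \<rightarrow>\<^sub>M borel"
    using terminal_point_measurable[OF assms(1)] sets_Q by (simp cong: measurable_cong_sets)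
  have conv_sets: "convergent_curves \<in> sets Q"
    using convergent_curves_measurable[OF assms(1)] sets_Q by simp
  let ?Q = "restrict_space Q convergent_curves"
  have "Lim at_top \<in> ?Q \<rightarrow>\<^sub>M borel \<longleftrightarrow> terminal_point \<in> ?Q \<rightarrow>\<^sub>M (borel :: 'a measure)"
    by (rule measurable_cong) (simp add: terminal_point_def space_restrict_space)
  then have Lim: "Lim at_top \<in> ?Q \<rightarrow>\<^sub>M (borel :: 'a measure)"
    using measurable_restrict_space1[OF e] by blast
  have "emeasure (marginal_at_infinity Q) A
      = emeasure ?Q (Lim at_top -` A \<inter> space ?Q)"
    unfolding marginal_at_infinity_def using Lim A by (simp add: emeasure_distr)
  also have "\<dots> = emeasure Q (Lim at_top -` A \<inter> space ?Q)"
    using conv_sets by (intro emeasure_restrict_space) (auto simp: space_restrict_space)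
  also have "Lim at_top -` A \<inter> space ?Q = (terminal_point -` A \<inter> space Q) \<inter> convergent_curves"
    by (auto simp: terminal_point_def space_restrict_space)
  also have "emeasure Q \<dots> = emeasure Q (terminal_point -` A \<inter> space Q)"
    using conv conv_sets A by (intro emeasure_eq_AE) (auto elim!: eventually_mono)
  also have "\<dots> = emeasure (distr Q borel terminal_point) A"
    using A by (simp add: emeasure_distr)
  finally show "emeasure (marginal_at_infinity Q) A = emeasure (distr Q borel terminal_point) A" .
qed

section \<open>Weak convergence, transport cost and moments of laws of random variables\<close>

text \<open>
  Convergence need only be tested on a subbase: the open sets for which it holds contain the
  subbase and are closed under finite intersections and arbitrary unions.
\<close>

lemma limitin_weak_topologyI:
  fixes m :: "'i \<Rightarrow> 'a::topological_space measure"
  assumes "\<mu> \<in> borel_probs" and probs: "eventually (\<lambda>i. m i \<in> borel_probs) F"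
    and conv: "\<And>f :: 'a \<Rightarrow> real. continuous_on UNIV f \<Longrightarrow> bounded (range f) \<Longrightarrow>
      ((\<lambda>i. \<integral>x. f x \<partial>m i) \<longlongrightarrow> (\<integral>x. f x \<partial>\<mu>)) F"
  shows "limitin weak_topology m \<mu> F"
proof -
  define \<B> where "\<B> = {{\<mu> \<in> borel_probs. (\<integral>x. f x \<partial>\<mu>) \<in> U} | (f :: 'a \<Rightarrow> real) U.
        continuous_on UNIV f \<and> bounded (range f) \<and> open U}"
  have top: "weak_topology = topology_generated_by \<B>"
    unfolding weak_topology_def \<B>_def ..
  have "{\<mu> \<in> borel_probs. (\<integral>x. (0::real) \<partial>\<mu>) \<in> UNIV} \<in> \<B>"
    unfolding \<B>_def by (intro CollectI exI[of _ "\<lambda>_. 0"] exI[of _ UNIV]) simp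
  then have "\<mu> \<in> \<Union>\<B>" using \<open>\<mu> \<in> borel_probs\<close> by blast
  moreover have "eventually (\<lambda>i. m i \<in> U) F" if "generate_topology_on \<B> U" "\<mu> \<in> U" for U
    using that
  proof induction
    case (Basis S)
    then obtain f :: "'a \<Rightarrow> real" and V where f: "continuous_on UNIV f" "bounded (range f)" "open V"
      and S: "S = {\<mu> \<in> borel_probs. (\<integral>x. f x \<partial>\<mu>) \<in> V}"
      unfolding \<B>_def by blast
    have "(\<integral>x. f x \<partial>\<mu>) \<in> V" using Basis.prems S by blast
    then have "eventually (\<lambda>i. (\<integral>x. f x \<partial>m i) \<in> V) F"
      using conv[OF f(1,2)] f(3) by (simp add: tendsto_def)
    with probs show ?case unfolding S by eventually_elim simp
  next
    case (Int A B)
    then show ?case by (simp add: eventually_conj)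
  next
    case (UN K)
    then obtain A where "A \<in> K" "\<mu> \<in> A" by blast
    then have "eventually (\<lambda>i. m i \<in> A) F" by (rule UN.IH)
    then show ?case using \<open>A \<in> K\<close> by (auto elim: eventually_mono)
  qed simp
  ultimately show ?thesis
    unfolding limitin_def top openin_topology_generated_by_iff by simp
qed

lemma distr_in_borel_probs:
  assumes "prob_space M" "X \<in> M \<rightarrow>\<^sub>M borel"
  shows "distr M borel X \<in> borel_probs"
  using prob_space.prob_space_distr[OF assms] by (simp add: prob_measures_def)

lemma limitin_weak_topology_distr:
  fixes X :: "real \<Rightarrow> 'b \<Rightarrow> 'a::t2_space"
  assumes M: "prob_space M"
    and X[measurable]: "\<And>t. X t \<in> M \<rightarrow>\<^sub>M borel" and Y[measurable]: "Y \<in> M \<rightarrow>\<^sub>M borel"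
    and conv: "AE \<omega> in M. ((\<lambda>t. X t \<omega>) \<longlongrightarrow> Y \<omega>) at_top"
  shows "limitin weak_topology (\<lambda>t. distr M borel (X t)) (distr M borel Y) at_top"
proof (rule limitin_weak_topologyI)
  fix f :: "'a \<Rightarrow> real" assume f: "continuous_on UNIV f" "bounded (range f)"
  have f_borel[measurable]: "f \<in> borel_measurable borel"
    using f(1) by (rule borel_measurable_continuous_onI)
  obtain B where B: "\<And>x. norm (f x) \<le> B" using f(2) unfolding bounded_iff by blast
  interpret prob_space M by fact
  have "((\<lambda>t. \<integral>\<omega>. f (X t \<omega>) \<partial>M) \<longlongrightarrow> (\<integral>\<omega>. f (Y \<omega>) \<partial>M)) at_top"
  proof (rule integral_dominated_convergence_at_top[where w = "\<lambda>_. B"])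
    show "AE \<omega> in M. ((\<lambda>t. f (X t \<omega>)) \<longlongrightarrow> f (Y \<omega>)) at_top"
      using conv
    proof eventually_elim
      case (elim \<omega>)
      have "isCont f (Y \<omega>)" using f(1) by (simp add: continuous_on_eq_continuous_at)
      then show ?case using elim by (rule isCont_tendsto_compose)
    qed
  qed (use B in simp_all)
  then show "((\<lambda>t. \<integral>x. f x \<partial>distr M borel (X t)) \<longlongrightarrow> (\<integral>x. f x \<partial>distr M borel Y)) at_top"
    by (simp add: integral_distr)
qed (simp_all add: distr_in_borel_probs M)

lemma ennreal_powr_root_powr:
  assumes "p > 0"
  shows "ennreal_powr (ennreal_powr a (1 / p)) p = a"
proof (cases a)
  case (real r)
  then show ?thesis using assms by (simp add: ennreal_powr_def powr_powr)
qed (simp add: ennreal_powr_def)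

text \<open>
  The joint law of two random variables on the same space is a coupling of their laws.
\<close>

lemma wasserstein_distr_le:
  fixes X Y :: "'b \<Rightarrow> 'a::metric_space"
  assumes "p > 0" "prob_space M" and XY: "(\<lambda>\<omega>. (X \<omega>, Y \<omega>)) \<in> M \<rightarrow>\<^sub>M borel"
  shows "ennreal_powr (wasserstein p (distr M borel X) (distr M borel Y)) p
    \<le> (\<integral>\<^sup>+\<omega>. ennreal (dist (X \<omega>) (Y \<omega>) powr p) \<partial>M)"
proof -
  let ?\<pi> = "distr M borel (\<lambda>\<omega>. (X \<omega>, Y \<omega>))"
  have fst: "fst \<in> borel \<rightarrow>\<^sub>M (borel :: 'a measure)"
    by (rule borel_measurable_continuous_onI[OF continuous_on_fst[OF continuous_on_id]])
  have snd: "snd \<in> borel \<rightarrow>\<^sub>M (borel :: 'a measure)"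
    by (rule borel_measurable_continuous_onI[OF continuous_on_snd[OF continuous_on_id]])
  have "?\<pi> \<in> couplings (distr M borel X) (distr M borel Y)"
    using distr_in_borel_probs[OF assms(2) XY]
    by (simp add: couplings_def distr_distr[OF fst XY] distr_distr[OF snd XY] comp_def)
  then have "(INF \<pi>\<in>couplings (distr M borel X) (distr M borel Y).
      \<integral>\<^sup>+(x, y). ennreal (dist x y powr p) \<partial>\<pi>) \<le> (\<integral>\<^sup>+(x, y). ennreal (dist x y powr p) \<partial>?\<pi>)"
    by (rule INF_lower)
  also have "\<dots> = (\<integral>\<^sup>+\<omega>. ennreal (dist (X \<omega>) (Y \<omega>) powr p) \<partial>M)"
  proof -
    have "(\<lambda>z :: 'a \<times> 'a. dist (fst z) (snd z)) \<in> borel_measurable borel"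
      by (intro borel_measurable_continuous_onI continuous_on_dist continuous_on_fst
        continuous_on_snd continuous_on_id)
    then have "(\<lambda>z :: 'a \<times> 'a. ennreal (dist (fst z) (snd z) powr p)) \<in> borel_measurable borel"
      by measurable
    then show ?thesis using XY by (simp add: nn_integral_distr case_prod_beta)
  qed
  finally show ?thesis
    unfolding wasserstein_def using \<open>p > 0\<close> by (simp add: ennreal_powr_root_powr)
qed

text \<open>
  The reference point \<open>y\<close> for which the moment is known to be finite need not be \<open>origin\<close>; the
  change of reference point is absorbed into the additive constant, and
  \<open>(u + v) powr p \<le> (2 * u) powr p + (2 * v) powr p\<close> separates the two terms.
\<close>

lemma finite_moment_distr_of_linear_bound:
  fixes X X' :: "'b \<Rightarrow> 'a::metric_space"
  assumes M: "prob_space M" and "p \<ge> 0"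
    and X: "X \<in> M \<rightarrow>\<^sub>M borel" and X': "X' \<in> M \<rightarrow>\<^sub>M borel"
    and bound: "AE \<omega> in M. dist origin (X' \<omega>) \<le> A * dist origin (X \<omega>) + B" and "A \<ge> 0"
    and moment: "distr M borel X \<in> finite_moment_probs p"
  shows "distr M borel X' \<in> finite_moment_probs p"
proof -
  interpret prob_space M by fact
  have dist_borel: "(\<lambda>x. ennreal (dist x (y :: 'a) powr p)) \<in> borel_measurable borel" for y
  proof -
    have [measurable]: "(\<lambda>x. dist x y) \<in> borel_measurable borel"
      by (intro borel_measurable_continuous_onI continuous_intros)
    show ?thesis by measurable
  qed
  obtain y where "(\<integral>\<^sup>+x. ennreal (dist x y powr p) \<partial>distr M borel X) < \<infinity>"
    using moment unfolding finite_moment_probs_def by blast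
  then have fin: "(\<integral>\<^sup>+\<omega>. ennreal (dist (X \<omega>) y powr p) \<partial>M) < \<infinity>"
    using nn_integral_distr[OF X, of "\<lambda>x. ennreal (dist x y powr p)"] dist_borel by simp
  define C where "C = A * dist origin y + \<bar>B\<bar>"
  have "C \<ge> 0" unfolding C_def using \<open>A \<ge> 0\<close> by simp
  have "AE \<omega> in M. ennreal (dist (X' \<omega>) origin powr p)
      \<le> ennreal ((2 * A) powr p) * ennreal (dist (X \<omega>) y powr p) + ennreal ((2 * C) powr p)"
    using bound
  proof eventually_elim
    case (elim \<omega>)
    let ?r = "dist (X \<omega>) y"
    have "dist origin (X \<omega>) \<le> dist origin y + ?r" by (metis dist_commute dist_triangle)
    then have "A * dist origin (X \<omega>) \<le> A * (dist origin y + ?r)"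
      using \<open>A \<ge> 0\<close> by (rule mult_left_mono)
    then have "dist (X' \<omega>) origin \<le> A * ?r + C"
      using elim by (simp add: C_def algebra_simps dist_commute)
    also have "\<dots> \<le> max (2 * A * ?r) (2 * C)" by simp
    finally have "dist (X' \<omega>) origin powr p \<le> max (2 * A * ?r) (2 * C) powr p"
      using \<open>p \<ge> 0\<close> by (intro powr_mono2) auto
    also have "\<dots> \<le> (2 * A * ?r) powr p + (2 * C) powr p" by (simp add: max_def)
    also have "(2 * A * ?r) powr p = (2 * A) powr p * ?r powr p"
      using \<open>A \<ge> 0\<close> by (simp add: powr_mult)
    finally show ?case
      by (simp flip: ennreal_mult' ennreal_plus)
  qed
  then have "(\<integral>\<^sup>+\<omega>. ennreal (dist (X' \<omega>) origin powr p) \<partial>M)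
      \<le> (\<integral>\<^sup>+\<omega>. ennreal ((2 * A) powr p) * ennreal (dist (X \<omega>) y powr p) + ennreal ((2 * C) powr p) \<partial>M)"
    by (rule nn_integral_mono_AE)
  also have "\<dots> = ennreal ((2 * A) powr p) * (\<integral>\<^sup>+\<omega>. ennreal (dist (X \<omega>) y powr p) \<partial>M) + ennreal ((2 * C) powr p)"
    using measurable_compose[OF X dist_borel]
    by (simp add: nn_integral_add nn_integral_cmult emeasure_space_1)
  also have "\<dots> < \<infinity>" using fin by (simp add: ennreal_mult_less_top)
  finally have "(\<integral>\<^sup>+x. ennreal (dist x origin powr p) \<partial>distr M borel X') < \<infinity>"
    using nn_integral_distr[OF X', of "\<lambda>x. ennreal (dist x origin powr p)"] dist_borel by simp
  then show ?thesis
    unfolding finite_moment_probs_def using distr_in_borel_probs[OF M X'] by blast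
qed

section \<open>Supports of measures\<close>

lemma closed_measure_support: "closed (measure_support \<mu>)"
proof -
  have "- measure_support \<mu> = \<Union>{U. open U \<and> emeasure \<mu> U = 0}"
    unfolding measure_support_def by (auto simp: zero_less_iff_neq_zero)
  then have "open (- measure_support \<mu>)" by (simp add: open_Union)
  then show ?thesis by (simp add: closed_def)
qed

text \<open>
  Each point off the support has an open null neighbourhood, and finitely many of these cover \<open>C\<close>.
\<close>

lemma compact_null_of_disjoint_support:
  assumes sets: "sets \<mu> = sets borel" and "compact C" and disj: "C \<inter> measure_support \<mu> = {}"
  shows "emeasure \<mu> C = 0"
proof -
  let ?\<U> = "{U. open U \<and> emeasure \<mu> U = 0}"
  have "\<exists>U\<in>?\<U>. x \<in> U" if "x \<in> C" for x
    using that disj unfolding measure_support_def by (auto simp: zero_less_iff_neq_zero)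
  then have "C \<subseteq> \<Union>?\<U>" by blast
  then obtain \<F> where \<F>: "\<F> \<subseteq> ?\<U>" "finite \<F>" "C \<subseteq> \<Union>\<F>"
    using compactE[OF \<open>compact C\<close>, of ?\<U>] by blast
  have "\<Union>\<F> \<in> null_sets \<mu>"
    using \<F>(1,2) sets by (intro null_sets_UN'[of \<F> "\<lambda>U. U", simplified]) (auto simp: countable_finite null_sets_def)
  then show ?thesis
    using \<F>(3) emeasure_mono[of C "\<Union>\<F>" \<mu>] by (auto simp: null_sets_def)
qed

text \<open>
  Compactness of balls replaces second countability here: the complement of the support is a
  countable union of compact sets, namely of its points in a closed ball of radius \<open>n + 1\<close> that have
  distance at least \<open>1 / (m + 1)\<close> from every point of the support.
\<close>

lemma AE_in_measure_support:
  fixes \<mu> :: "'a::metric_space measure" and origin :: 'a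
  assumes sets: "sets \<mu> = sets borel" and balls: "\<And>R. R > 0 \<Longrightarrow> compact (cball origin R)"
  shows "AE x in \<mu>. x \<in> measure_support \<mu>"
proof -
  let ?S = "measure_support \<mu>"
  define C where "C n m = cball origin (real (Suc n)) \<inter> - (\<Union>s\<in>?S. ball s (1 / real (Suc m)))" for n m
  have compact: "compact (C n m)" for n m
    unfolding C_def by (intro compact_Int_closed balls closed_Compl open_UN) auto
  have null: "C n m \<in> null_sets \<mu>" for n m
  proof
    have "x \<in> (\<Union>s\<in>?S. ball s (1 / real (Suc m)))" if "x \<in> ?S" for x
      using that by (rule UN_I) simp
    then have "C n m \<inter> ?S = {}" unfolding C_def by blast
    then show "emeasure \<mu> (C n m) = 0"
      by (rule compact_null_of_disjoint_support[OF sets compact])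
    show "C n m \<in> sets \<mu>"
      unfolding sets using compact_imp_closed[OF compact] by (rule borel_closed)
  qed
  have cover: "x \<in> (\<Union>n m. C n m)" if "x \<notin> ?S" for x
  proof -
    obtain e where e: "e > 0" "ball x e \<subseteq> - ?S"
      using closed_measure_support[of \<mu>] \<open>x \<notin> ?S\<close> by (metis ComplI closed_def openE)
    obtain m where m: "1 / real (Suc m) < e" using nat_approx_posE[OF e(1)] by blast
    obtain n where n: "dist origin x \<le> real n" using real_arch_simple by blast
    have "x \<notin> ball s (1 / real (Suc m))" if "s \<in> ?S" for s
      using e(2) m that by (auto simp: subset_eq dist_commute)
    then have "x \<in> C n m" unfolding C_def using n by auto
    then show ?thesis by blast
  qed
  have "(\<Union>n m. C n m) \<in> null_sets \<mu>" by (intro null_sets_UN null)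
  then have "AE x in \<mu>. x \<notin> (\<Union>n m. C n m)" by (rule AE_not_in)
  then show ?thesis by eventually_elim (use cover in blast)
qed

lemma compactly_supported_distr:
  fixes X :: "'b \<Rightarrow> 'a::metric_space"
  assumes balls: "\<And>R. R > 0 \<Longrightarrow> compact (cball origin R)"
    and X: "X \<in> M \<rightarrow>\<^sub>M borel" and bound: "AE \<omega> in M. dist origin (X \<omega>) \<le> R"
  shows "compactly_supported (distr M borel X)"
proof -
  let ?U = "- cball origin (max R 1)"
  have "emeasure (distr M borel X) ?U = emeasure M (X -` ?U \<inter> space M)"
    using X by (intro emeasure_distr) auto
  also have "X -` ?U \<inter> space M = {\<omega> \<in> space M. X \<omega> \<in> ?U}" by blast
  also have "emeasure M \<dots> = 0"
    by (rule emeasure_eq_0_AE) (use bound in \<open>eventually_elim, auto\<close>)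
  finally have null: "emeasure (distr M borel X) ?U = 0" .
  have "open ?U" by (simp add: open_Compl)
  then have "measure_support (distr M borel X) \<subseteq> cball origin (max R 1)"
    using null unfolding measure_support_def by fastforce
  moreover have "compact (cball origin (max R 1))" by (rule balls) simp
  ultimately show ?thesis
    unfolding compactly_supported_def using closed_measure_support
    by (metis compact_Int_closed inf.absorb2)
qed

section \<open>Long-time behaviour of equilibria\<close>

text \<open>
  An optimal curve is eventually constant, so it converges, and its limit is the value at any time
  past the bound on the exit time.
\<close>

lemma optimal_curve_terminal_point:
  fixes \<Gamma> :: "'a::metric_space set"
  assumes "closed \<Gamma>" "z \<in> \<Gamma>"
    and g: "\<And>x. x \<in> \<Gamma> \<Longrightarrow> g x \<ge> 0" "Lg-lipschitz_on \<Gamma> g"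
    and D: "\<And>x y :: 'a. \<exists>T\<in>{0..D * dist x y}. \<exists>\<gamma>.
          (\<exists>L. L-lipschitz_on {0..T} \<gamma>) \<and> \<gamma> 0 = x \<and> \<gamma> T = y \<and>
          (AE t in lborel. t \<in> {0..T} \<longrightarrow> has_metric_derivative \<gamma> {0..T} t 1)"
    and "c > 0" and k: "\<And>t x. t \<ge> 0 \<Longrightarrow> c \<le> k t x"
    and opt: "\<gamma> \<in> optimal_curves \<Gamma> k g 0 x"
  shows "\<gamma> \<in> convergent_curves"
    and "t \<ge> (1 / c + Lg) * (D * dist x z) + g z \<Longrightarrow> terminal_point \<gamma> = \<gamma> t"
proof -
  let ?\<tau> = "(1 / c + Lg) * (D * dist x z) + g z"
  have const: "\<gamma> s = \<gamma> t" if "t \<ge> ?\<tau>" "s \<ge> ?\<tau>" for s t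
    using optimal_curve_eventually_constant[OF assms(1,2) g D \<open>c > 0\<close> k opt that] .
  have lim: "(\<gamma> \<longlongrightarrow> \<gamma> t) at_top" if "t \<ge> ?\<tau>" for t
  proof (rule tendsto_eventually)
    show "eventually (\<lambda>s. \<gamma> s = \<gamma> t) at_top"
      using eventually_ge_at_top[of ?\<tau>] by eventually_elim (rule const[OF that])
  qed
  have "\<gamma> \<in> lipschitz_curves" using opt unfolding optimal_curves_def admissible_def by blast
  then have "\<gamma> \<in> curves"
    by (auto simp: lipschitz_curves_def curves_def intro: lipschitz_on_continuous_on)
  then show conv: "\<gamma> \<in> convergent_curves"
    using lim[OF order_refl] unfolding convergent_curves_def by blast
  assume "t \<ge> ?\<tau>"
  then show "terminal_point \<gamma> = \<gamma> t"
    using tendsto_unique[OF _ tendsto_terminal_point[OF conv] lim] by simp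
qed

theorem theorem5p4:
  fixes origin :: "'a::metric_space"
    and \<Gamma> :: "'a set" and g :: "'a \<Rightarrow> real"
    and Lg D Kmin Kmax :: real
  assumes balls_compact: "\<And>R. R > 0 \<Longrightarrow> compact (cball origin R)"
    and \<Gamma>: "\<Gamma> \<noteq> {}" "closed \<Gamma>"
    and g: "\<And>x. x \<in> \<Gamma> \<Longrightarrow> g x \<ge> 0" "Lg-lipschitz_on \<Gamma> g"
    and D: "D > 0"
      "\<And>x y :: 'a. \<exists>T\<in>{0..D * dist x y}. \<exists>\<gamma>.
          (\<exists>L. L-lipschitz_on {0..T} \<gamma>) \<and> \<gamma> 0 = x \<and> \<gamma> T = y \<and>
          (AE t in lborel. t \<in> {0..T} \<longrightarrow> has_metric_derivative \<gamma> {0..T} t 1)"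
    and K_bounds: "Kmin > 0" "Kmax > 0" "Lg * Kmax < 1"
  shows "\<exists>\<alpha>>0. \<exists>t\<^sub>0\<ge>0. \<forall>(K :: 'a measure \<Rightarrow> 'a \<Rightarrow> real) (m\<^sub>0 :: 'a measure)
        (Q :: (real \<Rightarrow> 'a) measure) (\<psi> :: real \<Rightarrow> real).
    continuous_map (prod_topology weak_topology euclidean) euclideanreal (\<lambda>(\<mu>, x). K \<mu> x) \<and>
    (\<forall>\<mu>\<in>borel_probs. \<forall>x. K \<mu> x \<in> {Kmin..Kmax}) \<and>
    (\<forall>R>0. \<exists>L>0. \<forall>\<mu>\<in>borel_probs. \<forall>x\<^sub>1\<in>cball origin R. \<forall>x\<^sub>2\<in>cball origin R.
        \<bar>K \<mu> x\<^sub>1 - K \<mu> x\<^sub>2\<bar> \<le> L * dist x\<^sub>1 x\<^sub>2) \<and>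
    m\<^sub>0 \<in> borel_probs \<and>
    is_equilibrium \<Gamma> K g m\<^sub>0 Q \<and>
    (\<forall>R\<ge>0. \<psi> R \<ge> 0) \<and> mono_on {0..} \<psi> \<and> linear_growth \<psi> \<and>
    (\<forall>R>0. \<forall>s\<ge>0. \<forall>x\<in>cball origin R.
        \<forall>\<gamma>\<in>optimal_curves \<Gamma> (\<lambda>t. K (marginal_at Q t)) g s x.
          \<forall>t\<ge>0. \<gamma> t \<in> cball origin (\<psi> R)) \<longrightarrow>
    limitin weak_topology (marginal_at Q) (marginal_at_infinity Q) at_top \<and>
    (\<forall>p\<ge>1. m\<^sub>0 \<in> finite_moment_probs p \<longrightarrow>
       (\<forall>t\<ge>0. marginal_at Q t \<in> finite_moment_probs p) \<and>
       marginal_at_infinity Q \<in> finite_moment_probs p \<and>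
       (\<forall>t\<ge>t\<^sub>0. ennreal_powr (wasserstein p (marginal_at Q t) (marginal_at_infinity Q)) p
          \<le> ennreal (2 powr p) *
            (\<integral>\<^sup>+x\<in>- cball origin (\<alpha> * (t - t\<^sub>0)). ennreal (\<psi> (dist origin x) powr p) \<partial>m\<^sub>0))) \<and>
    (compactly_supported m\<^sub>0 \<longrightarrow>
       (\<forall>t\<ge>0. compactly_supported (marginal_at Q t)) \<and>
       compactly_supported (marginal_at_infinity Q) \<and>
       (\<exists>t\<^sub>1\<ge>0. \<forall>t\<ge>t\<^sub>1. marginal_at Q t = marginal_at_infinity Q))"
proof -
  obtain z where z: "z \<in> \<Gamma>" using \<Gamma>(1) by blast
  have Lg: "Lg \<ge> 0" using g(2) by (rule lipschitz_on_nonneg)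
  define a where "a = (1 / Kmin + Lg) * D"
  define t\<^sub>0 where "t\<^sub>0 = a * dist origin z + g z"
  have "1 / Kmin + Lg > 0" using K_bounds(1) Lg by (simp add: add_pos_nonneg)
  then have a: "a > 0" unfolding a_def using D(1) by simp
  have t\<^sub>0: "t\<^sub>0 \<ge> 0" unfolding t\<^sub>0_def using a g(1)[OF z] by simp
  have complete: "uniform_space_class.complete (UNIV :: 'a set)"
    by (rule complete_of_compact_cballs[OF balls_compact])
  have time_bound: "(1 / Kmin + Lg) * (D * dist x z) + g z \<le> a * dist origin x + t\<^sub>0" for x
  proof -
    have "a * dist x z \<le> a * (dist origin x + dist origin z)"
      using a dist_triangle2[of x z origin] by (intro mult_left_mono) (simp_all add: dist_commute)
    then show ?thesis unfolding t\<^sub>0_def by (simp add: a_def algebra_simps)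
  qed
  show ?thesis
  proof (rule exI[of _ "1 / a"], rule conjI, simp add: a, rule exI[of _ t\<^sub>0], rule conjI,
      rule t\<^sub>0, intro allI impI, goal_cases)
    case (1 K m\<^sub>0 Q \<psi>)
    from 1 have K_range: "\<forall>\<mu>\<in>borel_probs. \<forall>x. K \<mu> x \<in> {Kmin..Kmax}" by (elim conjE)
    from 1 have equilibrium: "is_equilibrium \<Gamma> K g m\<^sub>0 Q" by (elim conjE)
    from 1 have \<psi>_mono: "mono_on {0..} \<psi>" by (elim conjE)
    from 1 have \<psi>_growth: "linear_growth \<psi>" by (elim conjE)
    from 1 have \<psi>_ball: "\<forall>R>0. \<forall>s\<ge>0. \<forall>x\<in>cball origin R.
        \<forall>\<gamma>\<in>optimal_curves \<Gamma> (\<lambda>t. K (marginal_at Q t)) g s x.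
          \<forall>t\<ge>0. \<gamma> t \<in> cball origin (\<psi> R)" by (elim conjE)
    have Q: "prob_space Q" and sets_Q: "sets Q = sets curve_borel"
      and m\<^sub>0: "m\<^sub>0 = distr Q borel (\<lambda>\<gamma>. \<gamma> 0)"
      and Q_opt: "AE \<gamma> in Q. \<gamma> \<in> optimal_curves \<Gamma> (\<lambda>t. K (marginal_at Q t)) g 0 (\<gamma> 0)"
      using equilibrium by (simp_all add: is_equilibrium_def prob_measures_def marginal_at_def)
    interpret prob_space Q by (rule Q)
    have eval[measurable]: "(\<lambda>\<gamma>. \<gamma> t) \<in> Q \<rightarrow>\<^sub>M borel" for t
      unfolding measurable_cong_sets[OF sets_Q refl] by (rule evaluation_measurable)
    have terminal[measurable]: "terminal_point \<in> Q \<rightarrow>\<^sub>M borel"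
      unfolding measurable_cong_sets[OF sets_Q refl] by (rule terminal_point_measurable[OF complete])
    have K_lower: "Kmin \<le> K (marginal_at Q t) x" for t x
      using K_range distr_in_borel_probs[OF Q eval[of t]] unfolding marginal_at_def by auto
    have terminal_facts: "\<gamma> \<in> convergent_curves"
        "t \<ge> (1 / Kmin + Lg) * (D * dist x z) + g z \<Longrightarrow> terminal_point \<gamma> = \<gamma> t"
      if "\<gamma> \<in> optimal_curves \<Gamma> (\<lambda>t. K (marginal_at Q t)) g 0 x" for \<gamma> x t
      using optimal_curve_terminal_point[of \<Gamma> z g, OF \<Gamma>(2) z g D(2) K_bounds(1) K_lower that]
      by simp_all
    have Q_conv: "AE \<gamma> in Q. \<gamma> \<in> convergent_curves"
      using Q_opt by eventually_elim (rule terminal_facts(1))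
    have Q_terminal: "AE \<gamma> in Q. \<forall>t\<ge>a * dist origin (\<gamma> 0) + t\<^sub>0. terminal_point \<gamma> = \<gamma> t"
      using Q_opt
    proof eventually_elim
      case (elim \<gamma>)
      show ?case
        using terminal_facts(2)[OF elim] order_trans[OF time_bound] by blast
    qed
    have Q_ball: "AE \<gamma> in Q. \<forall>R>0. dist origin (\<gamma> 0) \<le> R \<longrightarrow>
        (\<forall>t\<ge>0. dist origin (\<gamma> t) \<le> \<psi> R) \<and> dist origin (terminal_point \<gamma>) \<le> \<psi> R"
      using Q_opt Q_terminal
    proof eventually_elim
      case (elim \<gamma>)
      have "dist origin (\<gamma> t) \<le> \<psi> R" if "R > 0" "dist origin (\<gamma> 0) \<le> R" "t \<ge> 0" for R t
        using \<psi>_ball[rule_format, OF that(1) order_refl _ elim(1) that(3)] that(2) by simp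
      moreover have "terminal_point \<gamma> = \<gamma> (a * dist origin (\<gamma> 0) + t\<^sub>0)"
        using elim(2) by blast
      moreover have "a * dist origin (\<gamma> 0) + t\<^sub>0 \<ge> 0" using a t\<^sub>0 by simp
      ultimately show ?case by simp
    qed
    have m_t: "marginal_at Q t = distr Q borel (\<lambda>\<gamma>. \<gamma> t)" for t
      by (rule marginal_at_def)
    have m_inf: "marginal_at_infinity Q = distr Q borel terminal_point"
      by (rule marginal_at_infinity_eq_distr[OF complete sets_Q Q_conv])
    obtain A B where AB: "A \<ge> 0" "B \<ge> 0" "\<And>R. R \<ge> 0 \<Longrightarrow> \<psi> R \<le> A * R + B"
      using \<psi>_growth unfolding linear_growth_def by blast
    have Q_linear: "AE \<gamma> in Q. (\<forall>t\<ge>0. dist origin (\<gamma> t) \<le> A * dist origin (\<gamma> 0) + (A + B)) \<and>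
        dist origin (terminal_point \<gamma>) \<le> A * dist origin (\<gamma> 0) + (A + B)"
      using Q_ball
    proof eventually_elim
      case (elim \<gamma>)
      \<comment> \<open>The shift by 1 makes the radius positive also for curves that start at the origin.\<close>
      have "\<psi> (dist origin (\<gamma> 0) + 1) \<le> A * dist origin (\<gamma> 0) + (A + B)"
        using AB(3)[of "dist origin (\<gamma> 0) + 1"] by (simp add: algebra_simps)
      moreover have "dist origin (\<gamma> 0) + 1 > 0" "dist origin (\<gamma> 0) \<le> dist origin (\<gamma> 0) + 1"
        by (simp_all add: add_nonneg_pos)
      ultimately show ?case using elim by (meson order_trans)
    qed
    show ?case
    proof (intro conjI allI impI)
      show "limitin weak_topology (marginal_at Q) (marginal_at_infinity Q) at_top"
        unfolding m_inf m_t[abs_def]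
      proof (rule limitin_weak_topology_distr[OF Q eval terminal])
        show "AE \<gamma> in Q. ((\<lambda>t. \<gamma> t) \<longlongrightarrow> terminal_point \<gamma>) at_top"
          using Q_conv by eventually_elim (rule tendsto_terminal_point)
      qed
    next
      fix p t :: real assume "1 \<le> p" "m\<^sub>0 \<in> finite_moment_probs p" "0 \<le> t"
      have "AE \<gamma> in Q. dist origin (\<gamma> t) \<le> A * dist origin (\<gamma> 0) + (A + B)"
        using Q_linear by eventually_elim (use \<open>0 \<le> t\<close> in blast)
      then show "marginal_at Q t \<in> finite_moment_probs p"
        unfolding m_t using \<open>1 \<le> p\<close> \<open>m\<^sub>0 \<in> finite_moment_probs p\<close>[unfolded m\<^sub>0] AB(1)
        by (intro finite_moment_distr_of_linear_bound[OF Q _ eval[of 0] eval[of t]]) simp_all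
    next
      fix p :: real assume "1 \<le> p" "m\<^sub>0 \<in> finite_moment_probs p"
      have "AE \<gamma> in Q. dist origin (terminal_point \<gamma>) \<le> A * dist origin (\<gamma> 0) + (A + B)"
        using Q_linear by eventually_elim blast
      then show "marginal_at_infinity Q \<in> finite_moment_probs p"
        unfolding m_inf using \<open>1 \<le> p\<close> \<open>m\<^sub>0 \<in> finite_moment_probs p\<close>[unfolded m\<^sub>0] AB(1)
        by (intro finite_moment_distr_of_linear_bound[OF Q _ eval[of 0] terminal]) simp_all
    next
      fix p t :: real assume p: "1 \<le> p" and t: "t\<^sub>0 \<le> t"
      define h where "h x = ennreal (\<psi> (dist origin x) powr p) *
        indicator (- cball origin (1 / a * (t - t\<^sub>0))) x" for x
      have dist_borel[measurable]: "dist origin \<in> borel_measurable borel"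
        by (rule borel_measurable_continuous_onI[OF continuous_on_dist[OF continuous_on_const continuous_on_id]])
      have "mono (\<lambda>r. \<psi> (max 0 r))"
        using \<psi>_mono by (intro monoI) (auto simp: mono_on_def)
      then have [measurable]: "(\<lambda>r. \<psi> (max 0 r)) \<in> borel_measurable borel"
        by (rule borel_measurable_mono)
      have "(\<lambda>x. \<psi> (max 0 (dist origin x))) \<in> borel_measurable borel" by measurable
      then have [measurable]: "(\<lambda>x. \<psi> (dist origin x)) \<in> borel_measurable borel" by simp
      have h_borel: "h \<in> borel_measurable borel"
        unfolding h_def[abs_def] by (intro borel_measurable_times_ennreal) measurable
      have "ennreal_powr (wasserstein p (marginal_at Q t) (marginal_at_infinity Q)) p
          \<le> (\<integral>\<^sup>+\<gamma>. ennreal (dist (\<gamma> t) (terminal_point \<gamma>) powr p) \<partial>Q)"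
        unfolding m_t m_inf
      proof (rule wasserstein_distr_le[OF _ Q])
        show "(\<lambda>\<gamma>. (\<gamma> t, terminal_point \<gamma>)) \<in> Q \<rightarrow>\<^sub>M borel"
          unfolding measurable_cong_sets[OF sets_Q refl]
          by (rule terminal_pair_measurable[OF complete]) (use t t\<^sub>0 in linarith)
      qed (use p in simp)
      also have "\<dots> \<le> (\<integral>\<^sup>+\<gamma>. ennreal (2 powr p) * h (\<gamma> 0) \<partial>Q)"
      proof (rule nn_integral_mono_AE)
        show "AE \<gamma> in Q. ennreal (dist (\<gamma> t) (terminal_point \<gamma>) powr p) \<le> ennreal (2 powr p) * h (\<gamma> 0)"
          using Q_ball Q_terminal
        proof eventually_elim
          case (elim \<gamma>)
          show ?case
            \<comment> \<open>Curves that start close to the origin have already stopped at time \<open>t\<close>; the others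
               stay in the ball of radius \<open>\<psi> (dist origin (\<gamma> 0))\<close>.\<close>
          proof (cases "dist origin (\<gamma> 0) \<le> 1 / a * (t - t\<^sub>0)")
            case True
            then have "a * dist origin (\<gamma> 0) + t\<^sub>0 \<le> t" using a by (simp add: field_simps)
            then have "terminal_point \<gamma> = \<gamma> t" using elim(2) by blast
            then show ?thesis by simp
          next
            case False
            let ?R = "dist origin (\<gamma> 0)"
            have "0 \<le> 1 / a * (t - t\<^sub>0)" using a t by simp
            then have R: "?R > 0" using False by linarith
            have "dist (\<gamma> t) (terminal_point \<gamma>) \<le> dist origin (\<gamma> t) + dist origin (terminal_point \<gamma>)"
              by (metis dist_commute dist_triangle)
            also have "\<dots> \<le> \<psi> ?R + \<psi> ?R"
              using elim(1) R t t\<^sub>0 by (intro add_mono) simp_all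
            finally have le: "dist (\<gamma> t) (terminal_point \<gamma>) \<le> 2 * \<psi> ?R" by simp
            then have "\<psi> ?R \<ge> 0" using zero_le_dist[of "\<gamma> t" "terminal_point \<gamma>"] by linarith
            have "dist (\<gamma> t) (terminal_point \<gamma>) powr p \<le> (2 * \<psi> ?R) powr p"
              using le p by (intro powr_mono2) auto
            also have "\<dots> = 2 powr p * \<psi> ?R powr p" using \<open>\<psi> ?R \<ge> 0\<close> by (simp add: powr_mult)
            finally have "ennreal (dist (\<gamma> t) (terminal_point \<gamma>) powr p)
                \<le> ennreal (2 powr p) * ennreal (\<psi> ?R powr p)"
              by (simp add: ennreal_leI flip: ennreal_mult')
            moreover have "h (\<gamma> 0) = ennreal (\<psi> ?R powr p)" unfolding h_def using False by simp
            ultimately show ?thesis by simp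
          qed
        qed
      qed
      also have "\<dots> = ennreal (2 powr p) * (\<integral>\<^sup>+x. h x \<partial>m\<^sub>0)"
        unfolding m\<^sub>0 using measurable_compose[OF eval h_borel] h_borel
        by (simp add: nn_integral_cmult nn_integral_distr[OF eval])
      finally show "ennreal_powr (wasserstein p (marginal_at Q t) (marginal_at_infinity Q)) p
          \<le> ennreal (2 powr p) * (\<integral>\<^sup>+x\<in>- cball origin (1 / a * (t - t\<^sub>0)).
            ennreal (\<psi> (dist origin x) powr p) \<partial>m\<^sub>0)"
        unfolding h_def .
    next
      assume "compactly_supported m\<^sub>0"
      then have "bounded (measure_support m\<^sub>0)"
        unfolding compactly_supported_def by (rule compact_imp_bounded)
      then obtain R where "\<And>x. x \<in> measure_support m\<^sub>0 \<Longrightarrow> dist origin x \<le> R"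
        unfolding bounded_any_center[where a = origin] by blast
      moreover have "AE \<gamma> in Q. \<gamma> 0 \<in> measure_support m\<^sub>0"
        using AE_in_measure_support[OF _ balls_compact, of m\<^sub>0] eval[of 0]
        unfolding m\<^sub>0 by (intro AE_distrD[OF eval]) simp
      \<comment> \<open>The maximum with 1 makes the radius positive.\<close>
      ultimately have Q_start: "AE \<gamma> in Q. dist origin (\<gamma> 0) \<le> max R 1"
        by (auto elim!: eventually_mono simp: le_max_iff_disj)
      have R: "max R 1 > 0" by simp
      have Q_bounded: "AE \<gamma> in Q. (\<forall>t\<ge>0. dist origin (\<gamma> t) \<le> \<psi> (max R 1)) \<and>
          dist origin (terminal_point \<gamma>) \<le> \<psi> (max R 1)"
        using Q_ball Q_start by eventually_elim (use R in blast)
      show "compactly_supported (marginal_at Q t)" if "0 \<le> t" for t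
        unfolding m_t
      proof (rule compactly_supported_distr[OF balls_compact eval])
        show "AE \<gamma> in Q. dist origin (\<gamma> t) \<le> \<psi> (max R 1)"
          using Q_bounded by eventually_elim (use that in blast)
      qed
      show "compactly_supported (marginal_at_infinity Q)"
        unfolding m_inf
      proof (rule compactly_supported_distr[OF balls_compact terminal])
        show "AE \<gamma> in Q. dist origin (terminal_point \<gamma>) \<le> \<psi> (max R 1)"
          using Q_bounded by eventually_elim blast
      qed
      let ?T = "a * max R 1 + t\<^sub>0"
      have "marginal_at Q t = marginal_at_infinity Q" if "t \<ge> ?T" for t
        unfolding m_t m_inf
      proof (rule distr_cong_AE[OF refl refl _ eval terminal])
        show "AE \<gamma> in Q. \<gamma> t = terminal_point \<gamma>"
          using Q_terminal Q_start
        proof eventually_elim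
          case (elim \<gamma>)
          have "a * dist origin (\<gamma> 0) \<le> a * max R 1" using elim(2) a by simp
          then have "a * dist origin (\<gamma> 0) + t\<^sub>0 \<le> t" using \<open>t \<ge> ?T\<close> by linarith
          then show ?case using elim(1) by simp
        qed
      qed
      moreover have "?T \<ge> 0" using a t\<^sub>0 by (simp add: add_nonneg_nonneg)
      ultimately show "\<exists>t\<^sub>1\<ge>0. \<forall>t\<ge>t\<^sub>1. marginal_at Q t = marginal_at_infinity Q" by blast
    qed
  qed
qed

end
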